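(* Let $\Omega\subset\mathbb{R}^N$ be a bounded Lipschitz domain. Let $s,p\in C^{\mathrm{log}}(\overline{\Omega}\times\overline{\Omega})$ be symmetric log-Hölder continuous functions satisfying $0<s^{-}\leq s^{+}<1<p^{-}\leq p^{+}<N/s^{+}$, and let $q\in C(\overline{\Omega})$ be such that $p^{+}\leq q^{-}\leq q(x)\leq p_s^*(x)$ for all $x\in\Omega$. Assume that the continuous embedding $W^{s(x,y),p(x,y)}(\Omega)\hookrightarrow L^{p_s^*(x)}(\Omega)$ holds. Suppose that there exist $x_0\in\Omega$, $\beta\in(0,1)$, $C_0>0$ and $\eta>0$ (with $\eta\le 1$ and $B_\eta(x_0)\subset\Omega$, so that the expressions below are defined) such that for any $\rho\in(0,\eta)$, \[ \max_{x\in\partial B_\rho(x_0)}q(x)\leq\min_{x\in\partial B_\rho(x_0)}p_s^*(x)-\frac{C_0}{(-\log\rho)^\beta}, \] and \[ \inf_{x\in\Omega\setminus B_\eta(x_0)}(p_s^*(x)-q(x))>0. \] Then the embedding $W^{s(x,y),p(x,y)}(\Omega)\hookrightarrow L^{q(x)}(\Omega)$ is compact.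
   Context: Notation: for any variable exponent $\Phi$, $\Phi^{+}=\sup\Phi$ and $\Phi^{-}=\inf\Phi$ over its domain of definition. $B_\rho(x)$ is the open ball of radius $\rho$ centered at $x$. A function $f$ on a bounded set is log-Hölder continuous ($f\in C^{\mathrm{log}}$) if it is continuous and there is $C>0$ with $|f(x)-f(y)|\log\frac{1}{|x-y|}\leq C$ for all $x\neq y$ in the set. A function on $\overline\Omega\times\overline\Omega$ is symmetric if $f(x,y)=f(y,x)$. Critical Sobolev exponent: $p_s^*(x)=\dfrac{Np(x,x)}{N-p(x,x)s(x,x)}$. Nakano space: $L^{q(x)}(\Omega)$ is the set of measurable $u:\Omega\to\mathbb{R}$ with $\int_\Omega|u(x)|^{q(x)}dx<\infty$, with Luxemburg norm $\|u\|_{q(x)}=\inf\{\lambda>0\mid\int_\Omega|u(x)/\lambda|^{q(x)}dx\leq1\}$. Variable-order Sobolev space: define the modular \[ \varrho(u)=\int_\Omega\int_\Omega\frac{|u(x)-u(y)|^{p(x,y)}}{|x-y|^{N+s(x,y)p(x,y)}}dxdy+\int_\Omega|u|^{p(x,x)}dx \] and the norm $\|u\|=\inf\{\lambda>0\mid\varrho(u/\lambda)<1\}$ (with $\inf\emptyset=\infty$). Then $W^{s(x,y),p(x,y)}(\Omega)=\{u\in L^{p(x,x)}(\Omega)\mid\|u\|<\infty\}$ with norm $\|\cdot\|$. *)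

theory Defs
  imports "HOL-Analysis.Analysis"
begin

text \<open>
  The boundary is locally the graph of a Lipschitz function over a hyperplane orthogonal to
  some unit vector \<open>e\<close>, and the set lies locally on the side of the graph into which \<open>e\<close> points.
  The function \<open>\<phi>\<close> is defined on the hyperplane through the origin; \<open>x - (x \<bullet> e) *\<^sub>R e\<close> is the
  orthogonal projection onto it.
\<close>

definition lipschitz_boundary :: "'a::euclidean_space set \<Rightarrow> bool" where
  "lipschitz_boundary \<Omega> \<longleftrightarrow>
     (\<forall>z\<in>frontier \<Omega>. \<exists>e r L \<phi>. norm e = 1 \<and> r > 0 \<and> L-lipschitz_on {y. y \<bullet> e = 0} \<phi> \<and>
        \<Omega> \<inter> ball z r = {x \<in> ball z r. \<phi> (x - (x \<bullet> e) *\<^sub>R e) < x \<bullet> e})"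

definition bounded_lipschitz_domain :: "'a::euclidean_space set \<Rightarrow> bool" where
  "bounded_lipschitz_domain \<Omega> \<longleftrightarrow>
     open \<Omega> \<and> connected \<Omega> \<and> \<Omega> \<noteq> {} \<and> bounded \<Omega> \<and> lipschitz_boundary \<Omega>"

definition log_holder_on :: "'b::metric_space set \<Rightarrow> ('b \<Rightarrow> real) \<Rightarrow> bool" where
  "log_holder_on S f \<longleftrightarrow> continuous_on S f \<and>
     (\<exists>C>0. \<forall>x\<in>S. \<forall>y\<in>S. x \<noteq> y \<longrightarrow> \<bar>f x - f y\<bar> * ln (1 / dist x y) \<le> C)"

definition symmetric_on :: "'a set \<Rightarrow> ('a \<times> 'a \<Rightarrow> real) \<Rightarrow> bool" where
  "symmetric_on A f \<longleftrightarrow> (\<forall>x\<in>A. \<forall>y\<in>A. f (x, y) = f (y, x))"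

definition critical_exponent ::
    "('a::euclidean_space \<times> 'a \<Rightarrow> real) \<Rightarrow> ('a \<times> 'a \<Rightarrow> real) \<Rightarrow> 'a \<Rightarrow> real" where
  "critical_exponent s p x =
     real DIM('a) * p (x, x) / (real DIM('a) - p (x, x) * s (x, x))"

text \<open>
  Elements of the function spaces are functions on the whole type; only their values on \<open>\<Omega>\<close>
  matter. Functions equal almost everywhere are not identified, so the norms below are
  seminorms on functions. They take values in \<^typ>\<open>ennreal\<close>, where the infimum of the
  empty set is \<open>\<infinity>\<close>.
\<close>

definition nakano_space :: "'a::euclidean_space set \<Rightarrow> ('a \<Rightarrow> real) \<Rightarrow> ('a \<Rightarrow> real) set" where
  "nakano_space \<Omega> q = {u \<in> borel_measurable (lebesgue_on \<Omega>).
     (\<integral>\<^sup>+x. ennreal (\<bar>u x\<bar> powr q x) \<partial>lebesgue_on \<Omega>) < \<infinity>}"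

definition luxemburg_norm ::
    "'a::euclidean_space set \<Rightarrow> ('a \<Rightarrow> real) \<Rightarrow> ('a \<Rightarrow> real) \<Rightarrow> ennreal" where
  "luxemburg_norm \<Omega> q u =
     (INF l\<in>{l. 0 < l \<and> (\<integral>\<^sup>+x. ennreal (\<bar>u x / l\<bar> powr q x) \<partial>lebesgue_on \<Omega>) \<le> 1}. ennreal l)"

definition sobolev_modular ::
    "'a::euclidean_space set \<Rightarrow> ('a \<times> 'a \<Rightarrow> real) \<Rightarrow> ('a \<times> 'a \<Rightarrow> real) \<Rightarrow> ('a \<Rightarrow> real) \<Rightarrow> ennreal"
  where
  "sobolev_modular \<Omega> s p u =
     (\<integral>\<^sup>+y. (\<integral>\<^sup>+x. ennreal (\<bar>u x - u y\<bar> powr p (x, y) /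
          norm (x - y) powr (real DIM('a) + s (x, y) * p (x, y)))
        \<partial>lebesgue_on \<Omega>) \<partial>lebesgue_on \<Omega>)
     + (\<integral>\<^sup>+x. ennreal (\<bar>u x\<bar> powr p (x, x)) \<partial>lebesgue_on \<Omega>)"

definition sobolev_norm ::
    "'a::euclidean_space set \<Rightarrow> ('a \<times> 'a \<Rightarrow> real) \<Rightarrow> ('a \<times> 'a \<Rightarrow> real) \<Rightarrow> ('a \<Rightarrow> real) \<Rightarrow> ennreal"
  where
  "sobolev_norm \<Omega> s p u =
     (INF l\<in>{l. 0 < l \<and> sobolev_modular \<Omega> s p (\<lambda>x. u x / l) < 1}. ennreal l)"

definition sobolev_space ::
    "'a::euclidean_space set \<Rightarrow> ('a \<times> 'a \<Rightarrow> real) \<Rightarrow> ('a \<times> 'a \<Rightarrow> real) \<Rightarrow> ('a \<Rightarrow> real) set"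
  where
  "sobolev_space \<Omega> s p =
     {u \<in> nakano_space \<Omega> (\<lambda>x. p (x, x)). sobolev_norm \<Omega> s p u < \<infinity>}"

definition continuous_embedding ::
    "('a \<Rightarrow> real) set \<Rightarrow> (('a \<Rightarrow> real) \<Rightarrow> ennreal) \<Rightarrow>
     ('a \<Rightarrow> real) set \<Rightarrow> (('a \<Rightarrow> real) \<Rightarrow> ennreal) \<Rightarrow> bool" where
  "continuous_embedding V nV W nW \<longleftrightarrow>
     V \<subseteq> W \<and> (\<exists>C>0. \<forall>u\<in>V. nW u \<le> ennreal C * nV u)"

text \<open>Compactness: every bounded sequence of \<open>V\<close> has a subsequence converging in \<open>W\<close>.\<close>

definition compact_embedding ::
    "('a \<Rightarrow> real) set \<Rightarrow> (('a \<Rightarrow> real) \<Rightarrow> ennreal) \<Rightarrow>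
     ('a \<Rightarrow> real) set \<Rightarrow> (('a \<Rightarrow> real) \<Rightarrow> ennreal) \<Rightarrow> bool" where
  "compact_embedding V nV W nW \<longleftrightarrow>
     continuous_embedding V nV W nW \<and>
     (\<forall>u :: nat \<Rightarrow> 'a \<Rightarrow> real. (\<forall>n. u n \<in> V) \<and> (\<exists>M::real. \<forall>n. nV (u n) \<le> ennreal M) \<longrightarrow>
        (\<exists>v\<in>W. \<exists>r :: nat \<Rightarrow> nat. strict_mono r \<and>
           (\<lambda>n. nW (\<lambda>x. u (r n) x - v x)) \<longlonglongrightarrow> 0))"

end

theory Submission
  imports Defs "HOL-Complex_Analysis.Great_Picard"
begin

text \<open>
  The critical exponent \<open>r = p\<^sub>s\<^sup>*\<close> controls a bounded sequence only through a bound on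
  \<open>\<integral> \<bar>f\<^sub>n\<bar>\<^bsup>r\<^esup>\<close>, and compactness can be lost when mass concentrates at a point where \<open>q = r\<close>.
  In \<open>\<Omega>\<close> only \<open>x0\<close> can be such a point, and the gap \<open>r - q\<close> closes there no faster than
  \<open>C0 / (- ln \<rho>) powr \<beta>\<close>, where \<open>\<rho>\<close> is the distance to \<open>x0\<close>.

  The gap is used through a threshold \<open>T\<close> that depends on the point. Where \<open>\<bar>f\<bar> > T\<close>, we have
  \<open>\<bar>f\<bar>\<^bsup>q\<^esup> \<le> T\<^bsup>q - r\<^esup> \<bar>f\<bar>\<^bsup>r\<^esup>\<close>, hence everywhere
  \<open>\<bar>f\<bar>\<^bsup>q\<^esup> \<le> (min \<bar>f\<bar> T)\<^bsup>q\<^esup> + T\<^bsup>q - r\<^esup> \<bar>f\<bar>\<^bsup>r\<^esup>\<close>.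
  If \<open>T\<^bsup>q\<^esup>\<close> is integrable, the first term is handled by dominated convergence once \<open>f\<^sub>n \<rightarrow> 0\<close> almost
  everywhere; if \<open>T\<^bsup>q - r\<^esup> \<le> \<epsilon>\<close>, the second has integral at most \<open>\<epsilon>\<close> times the bound
  (\<open>nn_integral_powr_tendsto_zero\<close>). The choice is \<open>T = K max(1, \<rho>\<^bsup>-a\<^esup>)\<close> with \<open>a\<close> so small that
  \<open>T\<^bsup>q\<^esup>\<close> is integrable. Near \<open>x0\<close> this gives
  \<open>T\<^bsup>q - r\<^esup> \<le> \<rho>\<^bsup>a (r - q)\<^esup> \<le> exp (- a C0 (- ln \<rho>) powr (1 - \<beta>))\<close>, which tends to \<open>0\<close> precisely because
  \<open>\<beta> < 1\<close>. Away from \<open>x0\<close> the gap is bounded below, and a large \<open>K\<close> makes \<open>T\<^bsup>q - r\<^esup>\<close> small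
  (\<open>logarithmic_gap_integrable_threshold\<close>).

  It remains to extract from a bounded sequence a subsequence that converges almost everywhere. The
  Gagliardo part of the modular bounds the \<open>L\<^sup>1\<close> distance of \<open>u\<close> to its averages over small balls,
  uniformly along the sequence, and the averages take countably many values that converge along a
  diagonal subsequence (\<open>sobolev_bounded_imp_AE_convergent_subseq\<close>). The limit inherits the bound on
  the critical modular by Fatou's lemma, so the argument above applies to the differences.
\<close>

section \<open>Lebesgue measure on an open set\<close>

lemma measurable_lebesgue_onI:
  "f \<in> borel_measurable borel \<Longrightarrow> f \<in> borel_measurable (lebesgue_on \<Omega>)"
  by (intro measurable_restrict_space1 measurable_completion) simp

lemma measurable_continuous_on_lebesgue_on:
  fixes g :: "'a::euclidean_space \<Rightarrow> 'b::real_normed_vector"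
  assumes "continuous_on \<Omega> g" "open \<Omega>"
  shows "g \<in> borel_measurable (lebesgue_on \<Omega>)"
  using assms by (intro continuous_imp_measurable_on_sets_lebesgue) (auto intro: borel_open)

lemma measurable_continuous_on_pair_lebesgue_on:
  fixes g :: "'a::euclidean_space \<times> 'a \<Rightarrow> real"
  assumes g: "continuous_on (\<Omega> \<times> \<Omega>) g" and \<Omega>: "open \<Omega>"
  shows "g \<in> borel_measurable (lebesgue_on \<Omega> \<Otimes>\<^sub>M lebesgue_on \<Omega>)"
proof -
  let ?M = "lebesgue_on \<Omega>"
  have id: "(\<lambda>x. x) \<in> ?M \<rightarrow>\<^sub>M borel"
    using id_borel_measurable_lebesgue_on[of \<Omega>] by (simp add: id_def)
  have "(\<lambda>z. (fst z, snd z)) \<in> ?M \<Otimes>\<^sub>M ?M \<rightarrow>\<^sub>M borel \<Otimes>\<^sub>M borel"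
    by (intro measurable_Pair measurable_compose[OF measurable_fst id]
        measurable_compose[OF measurable_snd id])
  then have id2: "(\<lambda>z. z) \<in> ?M \<Otimes>\<^sub>M ?M \<rightarrow>\<^sub>M (borel :: ('a \<times> 'a) measure)"
    by (simp add: borel_prod)
  have "(\<lambda>z. indicator (\<Omega> \<times> \<Omega>) z *\<^sub>R g z) \<in> borel_measurable borel"
    using g \<Omega> by (intro borel_measurable_continuous_on_indicator borel_open open_Times)
  from measurable_compose[OF id2 this]
  have "(\<lambda>z. indicator (\<Omega> \<times> \<Omega>) z *\<^sub>R g z) \<in> borel_measurable (?M \<Otimes>\<^sub>M ?M)" .
  then show ?thesis
    by (rule measurable_cong[THEN iffD1, rotated]) (auto simp: space_pair_measure)
qed

lemma emeasure_lebesgue_on_self: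
  assumes "\<Omega> \<in> lmeasurable"
  shows "emeasure (lebesgue_on \<Omega>) \<Omega> = ennreal (measure lebesgue \<Omega>)"
proof -
  have "emeasure (lebesgue_on \<Omega>) \<Omega> = emeasure lebesgue \<Omega>"
    using assms by (intro emeasure_restrict_space) auto
  also have "\<dots> = ennreal (measure lebesgue \<Omega>)"
    by (rule emeasure_eq_measure2[OF assms])
  finally show ?thesis .
qed

lemma AE_lebesgue_on_neq:
  fixes \<Omega> :: "'a::euclidean_space set"
  assumes "\<Omega> \<in> sets lebesgue"
  shows "AE x in lebesgue_on \<Omega>. x \<noteq> x0"
proof -
  have "AE x in lebesgue. x \<noteq> x0"
    by (intro AE_completion AE_lborel_singleton)
  then show ?thesis
    using assms by (subst AE_restrict_space_iff) auto
qed

section \<open>Modulars with variable exponents\<close>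

lemma powr_le_truncated_plus:
  fixes t T q r :: real
  assumes "0 \<le> t" "0 < T" "q \<le> r"
  shows "t powr q \<le> min t T powr q + T powr (q - r) * t powr r"
proof (cases "t \<le> T")
  case True
  then show ?thesis by simp
next
  case False
  then have "t powr q = t powr (q - r) * t powr r"
    using assms by (simp flip: powr_add)
  also have "\<dots> \<le> T powr (q - r) * t powr r"
    using False assms by (intro mult_right_mono powr_mono2') auto
  finally show ?thesis
    by (simp add: add_increasing)
qed

lemma powr_le_one_plus_powr:
  fixes t q r :: real
  assumes "0 \<le> t" "0 \<le> q" "q \<le> r"
  shows "t powr q \<le> 1 + t powr r"
proof -
  have "t powr q \<le> min t 1 powr q + 1 powr (q - r) * t powr r"
    using assms by (intro powr_le_truncated_plus) auto
  moreover have "min t 1 powr q \<le> 1"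
    using assms by (intro powr_le1) auto
  ultimately show ?thesis by simp
qed

text \<open>
  A variant of Vitali's convergence theorem. The threshold may depend on the point; this is what lets
  \<open>r - q\<close> tend to zero somewhere, where no constant threshold \<open>T\<close> makes \<open>T powr (q x - r x)\<close>
  uniformly small.
\<close>

lemma nn_integral_powr_tendsto_zero:
  fixes f :: "nat \<Rightarrow> 'b \<Rightarrow> real" and q r :: "'b \<Rightarrow> real" and C :: real
  assumes f [measurable]: "\<And>n. f n \<in> borel_measurable M"
    and [measurable]: "q \<in> borel_measurable M" "r \<in> borel_measurable M"
    and q: "\<And>x. x \<in> space M \<Longrightarrow> 0 < q x \<and> q x \<le> r x"
    and lim: "AE x in M. (\<lambda>n. f n x) \<longlonglongrightarrow> 0"
    and bound: "\<And>n. (\<integral>\<^sup>+x. ennreal (\<bar>f n x\<bar> powr r x) \<partial>M) \<le> ennreal C"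
    and threshold: "\<And>\<epsilon>::real. 0 < \<epsilon> \<Longrightarrow> \<exists>T. T \<in> borel_measurable M \<and> (\<forall>x. 0 < T x) \<and>
          (\<integral>\<^sup>+x. ennreal (T x powr q x) \<partial>M) < \<infinity> \<and> (AE x in M. T x powr (q x - r x) \<le> \<epsilon>)"
  shows "(\<lambda>n. \<integral>\<^sup>+x. ennreal (\<bar>f n x\<bar> powr q x) \<partial>M) \<longlonglongrightarrow> 0"
proof (rule tendsto_zero_ennreal)
  fix e :: real assume e: "0 < e"
  define \<epsilon> where "\<epsilon> = e / (2 * (\<bar>C\<bar> + 1))"
  have \<epsilon>: "0 < \<epsilon>" using e by (simp add: \<epsilon>_def)
  have \<epsilon>C: "\<epsilon> * \<bar>C\<bar> \<le> e / 2"
    using e by (simp add: \<epsilon>_def field_simps)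
  obtain T where [measurable]: "T \<in> borel_measurable M" and T: "\<And>x. 0 < T x"
    and Tint: "(\<integral>\<^sup>+x. ennreal (T x powr q x) \<partial>M) < \<infinity>"
    and Tsmall: "AE x in M. T x powr (q x - r x) \<le> \<epsilon>"
    using threshold[OF \<epsilon>] by blast
  \<comment> \<open>The truncated part vanishes by dominated convergence.\<close>
  have "(\<lambda>n. \<integral>\<^sup>+x. ennreal (min \<bar>f n x\<bar> (T x) powr q x) \<partial>M) \<longlonglongrightarrow> (\<integral>\<^sup>+x. 0 \<partial>M)"
  proof (rule nn_integral_dominated_convergence[where w = "\<lambda>x. ennreal (T x powr q x)"])
    show "AE x in M. ennreal (min \<bar>f j x\<bar> (T x) powr q x) \<le> ennreal (T x powr q x)" for j
      using q T by (intro AE_I2 ennreal_leI powr_mono2) (auto simp: less_imp_le)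
    show "AE x in M. (\<lambda>n. ennreal (min \<bar>f n x\<bar> (T x) powr q x)) \<longlonglongrightarrow> 0"
      using lim AE_space
    proof eventually_elim
      case (elim x)
      have "(\<lambda>n. \<bar>f n x\<bar>) \<longlonglongrightarrow> 0"
        using elim(1) tendsto_rabs_zero by blast
      then have "(\<lambda>n. min \<bar>f n x\<bar> (T x)) \<longlonglongrightarrow> min 0 (T x)"
        by (intro tendsto_min tendsto_const)
      then have "(\<lambda>n. min \<bar>f n x\<bar> (T x)) \<longlonglongrightarrow> 0"
        using T[of x] by (simp add: min_def)
      then have "(\<lambda>n. min \<bar>f n x\<bar> (T x) powr q x) \<longlonglongrightarrow> 0"
        using q elim(2) T[of x] by (intro tendsto_zero_powrI[OF _ tendsto_const]) (auto simp: less_imp_le)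
      then show ?case
        by (subst ennreal_tendsto_0_iff) auto
    qed
  qed (use Tint in auto)
  then have "\<forall>\<^sub>F n in sequentially.
      (\<integral>\<^sup>+x. ennreal (min \<bar>f n x\<bar> (T x) powr q x) \<partial>M) < ennreal (e / 4)"
    using e by (auto dest!: order_tendstoD(2)[where a = "ennreal (e/4)"])
  then show "\<forall>\<^sub>F n in sequentially. (\<integral>\<^sup>+x. ennreal (\<bar>f n x\<bar> powr q x) \<partial>M) < ennreal e"
  proof eventually_elim
    case (elim n)
    have "(\<integral>\<^sup>+x. ennreal (\<bar>f n x\<bar> powr q x) \<partial>M)
        \<le> (\<integral>\<^sup>+x. ennreal (min \<bar>f n x\<bar> (T x) powr q x) + ennreal \<epsilon> * ennreal (\<bar>f n x\<bar> powr r x) \<partial>M)"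
    proof (rule nn_integral_mono_AE)
      show "AE x in M. ennreal (\<bar>f n x\<bar> powr q x)
          \<le> ennreal (min \<bar>f n x\<bar> (T x) powr q x) + ennreal \<epsilon> * ennreal (\<bar>f n x\<bar> powr r x)"
        using Tsmall AE_space
      proof eventually_elim
        case (elim x)
        have "\<bar>f n x\<bar> powr q x
            \<le> min \<bar>f n x\<bar> (T x) powr q x + T x powr (q x - r x) * \<bar>f n x\<bar> powr r x"
          using q elim(2) T by (intro powr_le_truncated_plus) auto
        also have "\<dots> \<le> min \<bar>f n x\<bar> (T x) powr q x + \<epsilon> * \<bar>f n x\<bar> powr r x"
          using elim(1) by (intro add_left_mono mult_right_mono) auto
        finally show ?case
          using \<epsilon> by (simp flip: ennreal_mult ennreal_plus)
      qed
    qed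
    also have "\<dots> = (\<integral>\<^sup>+x. ennreal (min \<bar>f n x\<bar> (T x) powr q x) \<partial>M)
        + ennreal \<epsilon> * (\<integral>\<^sup>+x. ennreal (\<bar>f n x\<bar> powr r x) \<partial>M)"
      by (simp add: nn_integral_add nn_integral_cmult)
    also have "\<dots> \<le> (\<integral>\<^sup>+x. ennreal (min \<bar>f n x\<bar> (T x) powr q x) \<partial>M) + ennreal \<epsilon> * ennreal \<bar>C\<bar>"
      by (intro add_left_mono mult_left_mono order_trans[OF bound] ennreal_leI) auto
    also have "\<dots> \<le> (\<integral>\<^sup>+x. ennreal (min \<bar>f n x\<bar> (T x) powr q x) \<partial>M) + ennreal (e / 2)"
      using \<epsilon> \<epsilon>C by (simp add: ennreal_leI flip: ennreal_mult)
    also have "\<dots> \<le> ennreal (e / 4) + ennreal (e / 2)"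
      using elim by (intro add_right_mono) auto
    also have "\<dots> < ennreal e"
      using e by (simp add: ennreal_less_iff flip: ennreal_plus)
    finally show ?case .
  qed
qed

lemma nn_integral_powr_Fatou:
  fixes f :: "nat \<Rightarrow> 'b \<Rightarrow> real"
  assumes [measurable]: "\<And>n. f n \<in> borel_measurable M" "r \<in> borel_measurable M"
    and r: "\<And>x. x \<in> space M \<Longrightarrow> 0 < r x"
    and lim: "AE x in M. (\<lambda>n. f n x) \<longlonglongrightarrow> g x"
    and bound: "\<And>n. (\<integral>\<^sup>+x. ennreal (\<bar>f n x\<bar> powr r x) \<partial>M) \<le> C"
  shows "(\<integral>\<^sup>+x. ennreal (\<bar>g x\<bar> powr r x) \<partial>M) \<le> C"
proof -
  have "(\<integral>\<^sup>+x. ennreal (\<bar>g x\<bar> powr r x) \<partial>M) = (\<integral>\<^sup>+x. liminf (\<lambda>n. ennreal (\<bar>f n x\<bar> powr r x)) \<partial>M)"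
  proof (rule nn_integral_cong_AE)
    show "AE x in M. ennreal (\<bar>g x\<bar> powr r x) = liminf (\<lambda>n. ennreal (\<bar>f n x\<bar> powr r x))"
      using lim AE_space
    proof eventually_elim
      case (elim x)
      have "(\<lambda>n. \<bar>f n x\<bar> powr r x) \<longlonglongrightarrow> \<bar>g x\<bar> powr r x"
        using r[OF elim(2)] by (intro tendsto_powr' tendsto_rabs elim tendsto_const) auto
      then have "(\<lambda>n. ennreal (\<bar>f n x\<bar> powr r x)) \<longlonglongrightarrow> ennreal (\<bar>g x\<bar> powr r x)"
        by (rule tendsto_ennrealI)
      then show ?case
        by (rule lim_imp_Liminf[OF trivial_limit_sequentially, symmetric])
    qed
  qed
  also have "\<dots> \<le> liminf (\<lambda>n. \<integral>\<^sup>+x. ennreal (\<bar>f n x\<bar> powr r x) \<partial>M)"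
    by (rule nn_integral_liminf) simp
  also have "\<dots> \<le> C"
    using bound by (intro Liminf_le) auto
  finally show ?thesis .
qed

lemma nn_integral_powr_diff_le:
  fixes f g :: "'b \<Rightarrow> real"
  assumes [measurable]: "f \<in> borel_measurable M" "g \<in> borel_measurable M" "r \<in> borel_measurable M"
    and r: "\<And>x. x \<in> space M \<Longrightarrow> 0 \<le> r x \<and> r x \<le> R"
  shows "(\<integral>\<^sup>+x. ennreal (\<bar>f x - g x\<bar> powr r x) \<partial>M)
    \<le> ennreal (2 powr R) * ((\<integral>\<^sup>+x. ennreal (\<bar>f x\<bar> powr r x) \<partial>M) + (\<integral>\<^sup>+x. ennreal (\<bar>g x\<bar> powr r x) \<partial>M))"
proof -
  have "ennreal (\<bar>f x - g x\<bar> powr r x) \<le> ennreal (2 powr R) * (ennreal (\<bar>f x\<bar> powr r x) + ennreal (\<bar>g x\<bar> powr r x))"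
    if x: "x \<in> space M" for x
  proof -
    have "\<bar>f x - g x\<bar> powr r x \<le> (2 * max \<bar>f x\<bar> \<bar>g x\<bar>) powr r x"
      using r[OF x] by (intro powr_mono2) auto
    also have "\<dots> = 2 powr r x * max \<bar>f x\<bar> \<bar>g x\<bar> powr r x"
      by (simp add: powr_mult)
    also have "\<dots> \<le> 2 powr R * (\<bar>f x\<bar> powr r x + \<bar>g x\<bar> powr r x)"
      using r[OF x] by (intro mult_mono powr_mono) (auto simp: max_def)
    finally show ?thesis
      by (simp add: ennreal_leI flip: ennreal_mult ennreal_plus)
  qed
  then have "(\<integral>\<^sup>+x. ennreal (\<bar>f x - g x\<bar> powr r x) \<partial>M)
      \<le> (\<integral>\<^sup>+x. ennreal (2 powr R) * (ennreal (\<bar>f x\<bar> powr r x) + ennreal (\<bar>g x\<bar> powr r x)) \<partial>M)"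
    by (rule nn_integral_mono)
  also have "\<dots> = ennreal (2 powr R) * ((\<integral>\<^sup>+x. ennreal (\<bar>f x\<bar> powr r x) \<partial>M) + (\<integral>\<^sup>+x. ennreal (\<bar>g x\<bar> powr r x) \<partial>M))"
    by (simp add: nn_integral_cmult nn_integral_add)
  finally show ?thesis .
qed

lemma nn_integral_powr_scale_le:
  fixes f :: "'b \<Rightarrow> real"
  assumes [measurable]: "f \<in> borel_measurable M" "r \<in> borel_measurable M"
    and r: "\<And>x. x \<in> space M \<Longrightarrow> 0 \<le> r x \<and> r x \<le> R"
  shows "(\<integral>\<^sup>+x. ennreal (\<bar>c * f x\<bar> powr r x) \<partial>M)
    \<le> ennreal (max 1 \<bar>c\<bar> powr R) * (\<integral>\<^sup>+x. ennreal (\<bar>f x\<bar> powr r x) \<partial>M)"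
proof -
  have "ennreal (\<bar>c * f x\<bar> powr r x) \<le> ennreal (max 1 \<bar>c\<bar> powr R) * ennreal (\<bar>f x\<bar> powr r x)"
    if x: "x \<in> space M" for x
  proof -
    have "\<bar>c * f x\<bar> powr r x \<le> (max 1 \<bar>c\<bar> * \<bar>f x\<bar>) powr r x"
      using r[OF x] by (intro powr_mono2) (auto simp: abs_mult intro: mult_right_mono)
    also have "\<dots> = max 1 \<bar>c\<bar> powr r x * \<bar>f x\<bar> powr r x"
      by (simp add: powr_mult)
    also have "\<dots> \<le> max 1 \<bar>c\<bar> powr R * \<bar>f x\<bar> powr r x"
      using r[OF x] by (intro mult_right_mono powr_mono) auto
    finally show ?thesis
      by (simp add: ennreal_leI flip: ennreal_mult)
  qed
  then show ?thesis
    by (subst nn_integral_cmult[symmetric]) (auto intro!: nn_integral_mono)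
qed

section \<open>Thresholds under a logarithmic gap\<close>

text \<open>
  On the dyadic shell of radius about \<open>2\<^bsup>-k\<^esup>\<close> the function is at most \<open>2\<^bsup>(k + 1) \<gamma>\<^esup>\<close>, and the
  ball containing the shell has volume proportional to \<open>2\<^bsup>-k N\<^esup>\<close>, where \<open>N\<close> is the dimension. The
  series of the products is geometric with ratio \<open>2\<^bsup>\<gamma> - N\<^esup> < 1\<close>.
\<close>

lemma nn_integral_dist_powr_ball_finite:
  fixes x0 :: "'a::euclidean_space" and \<gamma> :: real
  assumes "0 \<le> \<gamma>" "\<gamma> < DIM('a)"
  shows "(\<integral>\<^sup>+x. ennreal (dist x x0 powr - \<gamma>) * indicator (ball x0 1) x \<partial>lborel) < \<infinity>"
proof -
  define c where "c k = 2 powr (real (Suc k) * \<gamma>)" for k :: nat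
  define B where "B k = ball x0 ((1/2) ^ k)" for k :: nat
  define V where "V = unit_ball_vol (real DIM('a))"
  define \<theta> where "\<theta> = 2 powr (\<gamma> - DIM('a))"
  have V: "0 \<le> V" by (simp add: V_def)
  have pw: "ennreal (dist x x0 powr - \<gamma>) * indicator (ball x0 1) x
      \<le> (\<Sum>k. ennreal (c k) * indicator (B k) x)" for x
  proof (cases "x \<in> ball x0 1 \<and> x \<noteq> x0")
    case True
    define \<rho> where "\<rho> = dist x x0"
    have \<rho>: "0 < \<rho>" "\<rho> < 1"
      using True by (auto simp: \<rho>_def dist_commute)
    obtain m where m: "(1/2::real) ^ m < \<rho>"
      using real_arch_pow_inv[OF \<rho>(1), of "1/2"] by auto
    define k where "k = (LEAST m. (1/2::real) ^ Suc m \<le> \<rho>)"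
    have ex: "(1/2::real) ^ Suc m \<le> \<rho>"
      using m by (smt (verit) half_gt_zero power_Suc zero_less_power mult_le_cancel_right1 field_sum_of_halves)
    have k1: "(1/2::real) ^ Suc k \<le> \<rho>"
      unfolding k_def by (rule LeastI, rule ex)
    have k2: "\<rho> < (1/2) ^ k"
    proof (cases k)
      case 0
      then show ?thesis using \<rho> by simp
    next
      case (Suc j)
      then have "\<not> (1/2::real) ^ Suc j \<le> \<rho>"
        unfolding k_def by (metis lessI not_less_Least)
      then show ?thesis using Suc by simp
    qed
    have "\<rho> powr - \<gamma> \<le> ((1/2::real) ^ Suc k) powr - \<gamma>"
      using k1 assms by (intro powr_mono2') auto
    also have "(1/2::real) ^ Suc k = 2 powr - real (Suc k)"
      by (subst powr_minus, subst powr_realpow) (auto simp: power_divide inverse_eq_divide)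
    also have "(2 powr - real (Suc k)) powr - \<gamma> = c k"
      by (simp add: c_def powr_powr algebra_simps)
    finally have "ennreal (\<rho> powr - \<gamma>) \<le> ennreal (c k) * indicator (B k) x"
      using k2 by (simp add: B_def \<rho>_def dist_commute ennreal_leI)
    also have "\<dots> \<le> (\<Sum>k. ennreal (c k) * indicator (B k) x)"
    proof -
      define F where "F k = ennreal (c k) * indicator (B k) x" for k
      have "sum F {k} \<le> suminf F"
        by (intro sum_le_suminf summableI) auto
      then have "F k \<le> suminf F" by simp
      then show ?thesis by (simp only: F_def[abs_def])
    qed
    finally show ?thesis
      using True by (simp add: \<rho>_def)
  qed auto
  have "(\<integral>\<^sup>+x. ennreal (dist x x0 powr - \<gamma>) * indicator (ball x0 1) x \<partial>lborel)
      \<le> (\<integral>\<^sup>+x. (\<Sum>k. ennreal (c k) * indicator (B k) x) \<partial>lborel)"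
    by (intro nn_integral_mono pw)
  also have "\<dots> = (\<Sum>k. \<integral>\<^sup>+x. ennreal (c k) * indicator (B k) x \<partial>lborel)"
  proof (rule nn_integral_suminf)
    have [measurable]: "B k \<in> sets borel" for k by (simp add: B_def)
    show "(\<lambda>x. ennreal (c k) * indicator (B k) x) \<in> borel_measurable lborel" for k
      by measurable
  qed
  also have "\<dots> = (\<Sum>k. ennreal (2 powr \<gamma> * V * \<theta> ^ k))"
  proof (rule suminf_cong)
    fix k
    have "(\<integral>\<^sup>+x. ennreal (c k) * indicator (B k) x \<partial>lborel) = ennreal (c k * (V * ((1/2) ^ k) ^ DIM('a)))"
      by (simp add: nn_integral_cmult_indicator B_def emeasure_ball V_def ennreal_mult c_def)
    also have "c k * (V * ((1/2) ^ k) ^ DIM('a)) = 2 powr \<gamma> * V * \<theta> ^ k"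
    proof -
      have "c k = 2 powr \<gamma> * (2 powr \<gamma>) ^ k"
        by (simp add: c_def powr_power algebra_simps flip: powr_add)
      moreover have "\<theta> = 2 powr \<gamma> * (1/2) ^ DIM('a)"
        by (simp add: \<theta>_def powr_diff powr_realpow power_divide)
      moreover have "((1/2::real) ^ k) ^ DIM('a) = ((1/2) ^ DIM('a)) ^ k"
        by (simp only: mult.commute flip: power_mult)
      ultimately show ?thesis
        by (simp add: power_mult_distrib)
    qed
    finally show "(\<integral>\<^sup>+x. ennreal (c k) * indicator (B k) x \<partial>lborel) = ennreal (2 powr \<gamma> * V * \<theta> ^ k)" .
  qed
  also have "\<dots> < \<infinity>"
  proof -
    have "2 powr (\<gamma> - DIM('a)) < 2 powr 0"
      using assms by (intro powr_less_mono) auto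
    then have "summable (\<lambda>k. 2 powr \<gamma> * V * \<theta> ^ k)"
      by (intro summable_mult summable_geometric) (simp add: \<theta>_def)
    then show ?thesis
      using V by (subst suminf_ennreal2) (auto simp: \<theta>_def)
  qed
  finally show ?thesis .
qed

text \<open>
  Close to \<open>x0\<close> the factor \<open>dist x x0 powr - a\<close> alone suffices, whatever \<open>K \<ge> 1\<close> is: raised to the
  power \<open>- w x\<close> it is at most \<open>exp (- a C0 (- ln \<rho>) powr (1 - \<beta>))\<close> with \<open>\<rho> = dist x x0\<close>. Outside a
  small ball \<open>w\<close> is bounded below by some \<open>d > 0\<close>, and \<open>K\<close> is chosen so that \<open>K powr - d \<le> \<epsilon>\<close>.
\<close>

lemma logarithmic_gap_threshold:
  fixes x0 :: "'a::metric_space" and w :: "'a \<Rightarrow> real"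
  assumes "0 < a" "0 < C0" "0 < \<beta>" "\<beta> < 1" "0 < \<eta>" "\<eta> \<le> 1" "0 < c"
    and near: "\<And>x. x \<in> S \<Longrightarrow> 0 < dist x x0 \<Longrightarrow> dist x x0 < \<eta> \<Longrightarrow> C0 / (- ln (dist x x0)) powr \<beta> \<le> w x"
    and far: "\<And>x. x \<in> S \<Longrightarrow> \<eta> \<le> dist x x0 \<Longrightarrow> c \<le> w x"
    and \<epsilon>: "0 < \<epsilon>"
  shows "\<exists>K\<ge>1. \<forall>x\<in>S - {x0}. (K * max 1 (dist x x0 powr - a)) powr - w x \<le> \<epsilon>"
proof -
  have "((\<lambda>\<rho>::real. exp (- (a * C0) * (- ln \<rho>) powr (1 - \<beta>))) \<longlongrightarrow> 0) (at_right 0)"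
  proof -
    have 1: "filterlim (\<lambda>\<rho>::real. - ln \<rho>) at_top (at_right 0)"
      using ln_at_0 by (simp add: filterlim_uminus_at_top)
    have "filterlim (\<lambda>t::real. t powr (1 - \<beta>)) at_top at_top"
    proof (rule filterlim_mono_eventually[OF _ order_refl order_refl])
      show "filterlim (\<lambda>t::real. exp ((1 - \<beta>) * ln t)) at_top at_top"
        using assms by (intro filterlim_compose[OF exp_at_top]
            filterlim_tendsto_pos_mult_at_top[OF tendsto_const _ ln_at_top]) auto
      show "\<forall>\<^sub>F t::real in at_top. exp ((1 - \<beta>) * ln t) = t powr (1 - \<beta>)"
        using eventually_gt_at_top[of 0] by eventually_elim (simp add: powr_def)
    qed
    from filterlim_compose[OF this 1]
    have "filterlim (\<lambda>\<rho>::real. (- ln \<rho>) powr (1 - \<beta>)) at_top (at_right 0)" .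
    then have "filterlim (\<lambda>\<rho>::real. - (a * C0) * (- ln \<rho>) powr (1 - \<beta>)) at_bot (at_right 0)"
      using assms by (intro filterlim_tendsto_neg_mult_at_bot[OF tendsto_const]) auto
    then show ?thesis
      by (rule filterlim_compose[OF exp_at_bot])
  qed
  then have "\<forall>\<^sub>F \<rho> in at_right 0. exp (- (a * C0) * (- ln \<rho>) powr (1 - \<beta>)) < \<epsilon>"
    using \<epsilon> order_tendstoD(2) by blast
  then obtain b where b: "0 < b"
    and small: "\<And>\<rho>. 0 < \<rho> \<Longrightarrow> \<rho> < b \<Longrightarrow> exp (- (a * C0) * (- ln \<rho>) powr (1 - \<beta>)) < \<epsilon>"
    by (auto simp: eventually_at_right_field)
  define \<delta> where "\<delta> = min b \<eta> / 2"
  have \<delta>: "0 < \<delta>" "\<delta> < b" "\<delta> < \<eta>" "\<delta> < 1"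
    using b assms by (auto simp: \<delta>_def)
  define d where "d = min c (C0 / (- ln \<delta>) powr \<beta>)"
  have d: "0 < d"
    using \<delta> assms by (auto simp: d_def)
  define K where "K = max 1 (\<epsilon> powr (- 1 / d))"
  have K: "1 \<le> K" "K powr - d \<le> \<epsilon>"
  proof -
    have "K powr - d \<le> (\<epsilon> powr (- 1 / d)) powr - d"
      using d \<epsilon> by (intro powr_mono2') (auto simp: K_def)
    then show "K powr - d \<le> \<epsilon>"
      using d \<epsilon> by (simp add: powr_powr)
  qed (simp add: K_def)
  have "(K * max 1 (dist x x0 powr - a)) powr - w x \<le> \<epsilon>" if x: "x \<in> S" "x \<noteq> x0" for x
  proof -
    define \<rho> where "\<rho> = dist x x0"
    have \<rho>: "0 < \<rho>" using x by (simp add: \<rho>_def)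
    show ?thesis
    proof (cases "\<rho> < \<delta>")
      case True
      then have \<rho>1: "\<rho> < \<eta>" "\<rho> < b" "\<rho> < 1" using \<delta> by auto
      have w: "C0 / (- ln \<rho>) powr \<beta> \<le> w x"
        using near x(1) \<rho> \<rho>1 by (simp add: \<rho>_def)
      have ln: "0 < - ln \<rho>" using \<rho> \<rho>1 by simp
      have w0: "0 \<le> w x"
        using w assms by (meson divide_nonneg_nonneg less_imp_le order_trans powr_ge_zero)
      have "(K * max 1 (\<rho> powr - a)) powr - w x \<le> (\<rho> powr - a) powr - w x"
      proof (intro powr_mono2')
        have "1 * \<rho> powr - a \<le> K * max 1 (\<rho> powr - a)"
          using K by (intro mult_mono) auto
        then show "\<rho> powr - a \<le> K * max 1 (\<rho> powr - a)" by simp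
      qed (use \<rho> w0 in auto)
      also have "\<dots> = exp (- (a * (- ln \<rho>) * w x))"
        using \<rho> by (simp add: powr_def)
      also have "\<dots> \<le> exp (- (a * (- ln \<rho>) * (C0 / (- ln \<rho>) powr \<beta>)))"
        using w ln assms by (intro iffD2[OF exp_le_cancel_iff] le_imp_neg_le mult_left_mono mult_nonneg_nonneg) auto
      also have "a * (- ln \<rho>) * (C0 / (- ln \<rho>) powr \<beta>) = a * C0 * (- ln \<rho>) powr (1 - \<beta>)"
        using ln by (simp add: powr_diff)
      also have "exp (- (a * C0 * (- ln \<rho>) powr (1 - \<beta>))) \<le> \<epsilon>"
        using small[OF \<rho> \<rho>1(2)] by simp
      finally show ?thesis by (simp add: \<rho>_def)
    next
      case False
      have "d \<le> w x"
      proof (cases "\<rho> < \<eta>")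
        case True
        have "(- ln \<rho>) powr \<beta> \<le> (- ln \<delta>) powr \<beta>"
          using False True \<delta> assms by (intro powr_mono2) auto
        then have "C0 / (- ln \<delta>) powr \<beta> \<le> C0 / (- ln \<rho>) powr \<beta>"
          using True \<rho> assms by (intro divide_left_mono mult_pos_pos) (use \<delta> in auto)
        also have "\<dots> \<le> w x"
          using near x(1) \<rho> True by (simp add: \<rho>_def)
        finally show ?thesis by (simp add: d_def)
      next
        case False
        then show ?thesis using far[of x] x by (simp add: d_def \<rho>_def)
      qed
      have T1: "K \<le> K * max 1 (\<rho> powr - a)"
        using K by (simp add: mult_le_cancel_left1)
      have "(K * max 1 (\<rho> powr - a)) powr - w x \<le> K powr - w x"
        using K d \<open>d \<le> w x\<close> T1 by (intro powr_mono2') auto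
      also have "\<dots> \<le> K powr - d"
        using K \<open>d \<le> w x\<close> by (intro powr_mono) auto
      also have "\<dots> \<le> \<epsilon>" by (rule K(2))
      finally show ?thesis by (simp add: \<rho>_def)
    qed
  qed
  then show ?thesis using K(1) by blast
qed

text \<open>
  The exponent \<open>a\<close> is half the dimension divided by \<open>Q\<close>, so that \<open>T powr Q\<close> has at \<open>x0\<close> the
  singularity \<open>dist x x0 powr - (N / 2)\<close>, which is integrable in dimension \<open>N\<close>. At \<open>x0\<close> itself the
  smallness may fail, but this is a single point.
\<close>

lemma logarithmic_gap_integrable_threshold:
  fixes \<Omega> :: "'a::euclidean_space set"
  assumes \<Omega>: "open \<Omega>" "bounded \<Omega>"
    and gap: "0 < C0" "0 < \<beta>" "\<beta> < 1" "0 < \<eta>" "\<eta> \<le> 1" "0 < c"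
    and q: "\<And>x. x \<in> \<Omega> \<Longrightarrow> q x \<le> Q" "0 < Q"
    and near: "\<And>x. x \<in> \<Omega> \<Longrightarrow> 0 < dist x x0 \<Longrightarrow> dist x x0 < \<eta> \<Longrightarrow>
      C0 / (- ln (dist x x0)) powr \<beta> \<le> r x - q x"
    and far: "\<And>x. x \<in> \<Omega> \<Longrightarrow> \<eta> \<le> dist x x0 \<Longrightarrow> c \<le> r x - q x"
    and \<epsilon>: "0 < \<epsilon>"
  shows "\<exists>T. T \<in> borel_measurable (lebesgue_on \<Omega>) \<and> (\<forall>x. 0 < T x) \<and>
    (\<integral>\<^sup>+x. ennreal (T x powr q x) \<partial>lebesgue_on \<Omega>) < \<infinity> \<and>
    (AE x in lebesgue_on \<Omega>. T x powr (q x - r x) \<le> \<epsilon>)"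
proof -
  let ?M = "lebesgue_on \<Omega>"
  have \<Omega>m: "\<Omega> \<in> lmeasurable" using \<Omega> by (simp add: lmeasurable_open)
  define \<gamma> where "\<gamma> = real DIM('a) / 2"
  define a where "a = \<gamma> / Q"
  have \<gamma>: "0 \<le> \<gamma>" "\<gamma> < DIM('a)" and a: "0 < a" "a * Q = \<gamma>"
    using q(2) by (auto simp: \<gamma>_def a_def)
  obtain K where K: "1 \<le> K"
    and Ksmall: "\<And>x. x \<in> \<Omega> - {x0} \<Longrightarrow> (K * max 1 (dist x x0 powr - a)) powr - (r x - q x) \<le> \<epsilon>"
    using logarithmic_gap_threshold[OF a(1) gap, of \<Omega> x0 "\<lambda>x. r x - q x", OF near far \<epsilon>] by blast
  define T where "T x = K * max 1 (dist x x0 powr - a)" for x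
  have T1: "1 \<le> T x" for x
    using mult_mono[OF K max.cobounded1[of 1 "dist x x0 powr - a"]] K by (simp add: T_def)
  define F where "F x = ennreal (dist x x0 powr - \<gamma>) * indicator (ball x0 1) x" for x
  have F_borel: "F \<in> borel_measurable borel"
  proof -
    have [measurable]: "ball x0 1 \<in> sets borel" by simp
    show ?thesis unfolding F_def by measurable
  qed
  have F_meas [measurable]: "F \<in> borel_measurable ?M"
    using F_borel by (intro measurable_restrict_space1 measurable_completion) simp
  have T_le: "ennreal (T x powr q x) \<le> ennreal (K powr Q) * (1 + F x)" if "x \<in> \<Omega>" for x
  proof -
    have "T x powr q x \<le> T x powr Q"
      using T1 q(1)[OF that] by (intro powr_mono) auto
    also have "\<dots> = K powr Q * max 1 (dist x x0 powr - a) powr Q"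
      using K by (simp add: T_def powr_mult)
    finally have *: "T x powr q x \<le> K powr Q * max 1 (dist x x0 powr - a) powr Q" .
    show ?thesis
    proof (cases "x \<in> ball x0 1")
      case True
      have "max 1 (dist x x0 powr - a) powr Q \<le> 1 + dist x x0 powr - \<gamma>"
        using a by (auto simp: max_def powr_powr)
      then have "T x powr q x \<le> K powr Q * (1 + dist x x0 powr - \<gamma>)"
        using * by (meson mult_left_mono order_trans powr_ge_zero)
      then show ?thesis
        using True by (simp add: F_def ennreal_leI flip: ennreal_mult ennreal_plus ennreal_1)
    next
      case False
      then have "1 \<le> dist x x0" by (simp add: dist_commute)
      then have "dist x x0 powr - a \<le> 1 powr - a"
        using a by (intro powr_mono2') auto
      then have "max 1 (dist x x0 powr - a) = 1"
        by (auto simp: max_def)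
      then have "T x powr q x \<le> K powr Q" using * by simp
      then show ?thesis using False by (simp add: F_def ennreal_leI)
    qed
  qed
  have "(\<integral>\<^sup>+x. F x \<partial>?M) \<le> (\<integral>\<^sup>+x. F x \<partial>lborel)"
  proof -
    have "(\<integral>\<^sup>+x. F x \<partial>?M) = (\<integral>\<^sup>+x. F x * indicator \<Omega> x \<partial>lebesgue)"
      using \<Omega>m by (subst nn_integral_restrict_space) auto
    also have "\<dots> \<le> (\<integral>\<^sup>+x. F x \<partial>lebesgue)"
      by (intro nn_integral_mono) (auto simp: indicator_def)
    finally show ?thesis by (simp add: nn_integral_completion)
  qed
  also have "\<dots> < \<infinity>"
    unfolding F_def by (rule nn_integral_dist_powr_ball_finite[OF \<gamma>])
  finally have F_fin: "(\<integral>\<^sup>+x. F x \<partial>?M) < \<infinity>" .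
  have "(\<integral>\<^sup>+x. ennreal (T x powr q x) \<partial>?M) \<le> (\<integral>\<^sup>+x. ennreal (K powr Q) * (1 + F x) \<partial>?M)"
    using T_le by (intro nn_integral_mono) simp
  also have "\<dots> = ennreal (K powr Q) * (emeasure ?M \<Omega> + (\<integral>\<^sup>+x. F x \<partial>?M))"
    by (simp add: nn_integral_cmult nn_integral_add)
  also have "\<dots> < \<infinity>"
    using F_fin unfolding emeasure_lebesgue_on_self[OF \<Omega>m] by (simp add: ennreal_mult_less_top)
  finally have T_fin: "(\<integral>\<^sup>+x. ennreal (T x powr q x) \<partial>?M) < \<infinity>" .
  have "AE x in ?M. T x powr (q x - r x) \<le> \<epsilon>"
    using AE_lebesgue_on_neq[of \<Omega> x0, OF fmeasurableD[OF \<Omega>m]] AE_space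
  proof eventually_elim
    case (elim x)
    then show ?case using Ksmall[of x] by (simp add: T_def)
  qed
  moreover have "T \<in> borel_measurable ?M"
    unfolding T_def by (intro measurable_restrict_space1 measurable_completion) simp
  moreover have "\<forall>x. 0 < T x"
    using T1 by (meson less_le_trans zero_less_one)
  ultimately show ?thesis using T_fin by blast
qed

section \<open>Oscillation of functions of finite Gagliardo modular\<close>

definition gagliardo_density ::
    "('a::euclidean_space \<times> 'a \<Rightarrow> real) \<Rightarrow> ('a \<times> 'a \<Rightarrow> real) \<Rightarrow> ('a \<Rightarrow> real) \<Rightarrow> 'a \<Rightarrow> 'a \<Rightarrow> real"
  where
  "gagliardo_density s p u x y =
     \<bar>u x - u y\<bar> powr p (x, y) / norm (x - y) powr (real DIM('a) + s (x, y) * p (x, y))"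

lemma gagliardo_density_measurable:
  fixes \<Omega> :: "'a::euclidean_space set"
  assumes "open \<Omega>" "continuous_on (\<Omega> \<times> \<Omega>) s" "continuous_on (\<Omega> \<times> \<Omega>) p"
    and [measurable]: "u \<in> borel_measurable (lebesgue_on \<Omega>)"
  shows "(\<lambda>z. gagliardo_density s p u (fst z) (snd z))
      \<in> borel_measurable (lebesgue_on \<Omega> \<Otimes>\<^sub>M lebesgue_on \<Omega>)"
proof -
  let ?P = "lebesgue_on \<Omega> \<Otimes>\<^sub>M lebesgue_on \<Omega>"
  have [measurable]: "s \<in> borel_measurable ?P" "p \<in> borel_measurable ?P"
      "(\<lambda>z. norm (fst z - snd z)) \<in> borel_measurable ?P"
    using assms(1-3)
    by (auto intro!: measurable_continuous_on_pair_lebesgue_on continuous_intros)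
  show ?thesis
    unfolding gagliardo_density_def by measurable
qed

text \<open>
  Either the oscillation is at most \<open>\<rho> powr \<tau>\<close> with \<open>\<rho> = norm (x - y)\<close>, or its quotient by
  \<open>\<rho> powr \<tau>\<close> is at least \<open>1\<close> and grows when raised to the power \<open>p \<ge> 1\<close>. In the second case the
  powers of \<open>\<rho>\<close> recombine into the Gagliardo density because \<open>\<tau> \<le> s\<close> and \<open>\<rho> \<le> 1\<close>. This replaces
  the variable exponents by the single constant \<open>\<tau>\<close>.
\<close>

lemma oscillation_le_gagliardo_density:
  fixes x y :: "'a::euclidean_space"
  assumes xy: "norm (x - y) \<le> \<delta>" and \<delta>: "\<delta> \<le> 1" and \<tau>: "0 < \<tau>"
    and p: "1 \<le> p (x, y)" and s: "\<tau> \<le> s (x, y)"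
  shows "\<bar>u x - u y\<bar> \<le> \<delta> powr \<tau> + \<delta> powr (\<tau> + DIM('a)) * gagliardo_density s p u x y"
proof (cases "x = y")
  case True
  then show ?thesis by (simp add: gagliardo_density_def)
next
  case False
  define t where "t = \<bar>u x - u y\<bar>"
  define \<rho> where "\<rho> = norm (x - y)"
  define P where "P = p (x, y)"
  define S where "S = s (x, y)"
  have \<rho>: "0 < \<rho>" "\<rho> \<le> \<delta>" "\<rho> \<le> 1" using False xy \<delta> by (auto simp: \<rho>_def)
  have P: "1 \<le> P" and S: "\<tau> \<le> S" using p s by (auto simp: P_def S_def)
  have t: "0 \<le> t" by (simp add: t_def)
  have "t \<le> \<rho> powr \<tau> + \<rho> powr (\<tau> + DIM('a)) * (t powr P / \<rho> powr (DIM('a) + S * P))"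
  proof (cases "t \<le> \<rho> powr \<tau>")
    case True
    then show ?thesis by (simp add: add_increasing2)
  next
    case False
    define a where "a = t / \<rho> powr \<tau>"
    have a: "1 \<le> a" using False \<rho> by (simp add: a_def)
    have ta: "t = \<rho> powr \<tau> * a" using \<rho> by (simp add: a_def)
    have "t \<le> \<rho> powr \<tau> * a powr P"
      using powr_mono[OF P a] a \<rho> by (subst ta) simp
    also have "\<dots> = \<rho> powr (\<tau> - \<tau> * P) * t powr P"
      using \<rho> t by (simp add: a_def powr_divide powr_powr powr_diff)
    also have "\<dots> \<le> \<rho> powr (\<tau> - S * P) * t powr P"
      using \<rho> P S by (intro mult_right_mono powr_mono') (auto intro: mult_right_mono)
    also have "\<dots> = \<rho> powr (\<tau> + DIM('a)) * (t powr P / \<rho> powr (DIM('a) + S * P))"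
      using \<rho> by (simp add: powr_add powr_diff)
    finally show ?thesis by (simp add: add_increasing)
  qed
  also have "\<dots> \<le> \<delta> powr \<tau> + \<delta> powr (\<tau> + DIM('a)) * (t powr P / \<rho> powr (DIM('a) + S * P))"
    using \<rho> \<tau> by (intro add_mono mult_right_mono powr_mono2) auto
  finally show ?thesis
    by (simp add: gagliardo_density_def t_def \<rho>_def P_def S_def)
qed

text \<open>
  The volume of a ball of radius \<open>\<delta>\<close> is proportional to \<open>\<delta> ^ DIM('a)\<close>, so both terms of the pointwise
  bound contribute the order \<open>\<delta> powr (\<tau> + DIM('a))\<close>: after division by the volume of the ball the mean
  oscillation is of order \<open>\<delta> powr \<tau>\<close>, uniformly in \<open>u\<close>.
\<close>

lemma nn_integral_oscillation_le:
  fixes \<Omega> :: "'a::euclidean_space set"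
  assumes \<Omega>: "open \<Omega>" "bounded \<Omega>"
    and cont: "continuous_on (\<Omega> \<times> \<Omega>) s" "continuous_on (\<Omega> \<times> \<Omega>) p"
    and p: "\<And>z. z \<in> \<Omega> \<times> \<Omega> \<Longrightarrow> 1 \<le> p z" and s: "\<And>z. z \<in> \<Omega> \<times> \<Omega> \<Longrightarrow> \<tau> \<le> s z"
    and \<tau>: "0 < \<tau>" and \<delta>: "0 < \<delta>" "\<delta> \<le> 1"
    and u [measurable]: "u \<in> borel_measurable (lebesgue_on \<Omega>)"
    and mod: "(\<integral>\<^sup>+y. \<integral>\<^sup>+x. ennreal (gagliardo_density s p u x y) \<partial>lebesgue_on \<Omega> \<partial>lebesgue_on \<Omega>) \<le> 1"
  shows "(\<integral>\<^sup>+y. \<integral>\<^sup>+x. ennreal \<bar>u x - u y\<bar> * indicator (ball y \<delta>) x \<partial>lebesgue_on \<Omega> \<partial>lebesgue_on \<Omega>)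
      \<le> ennreal (\<delta> powr (\<tau> + DIM('a)) * (unit_ball_vol DIM('a) * measure lebesgue \<Omega> + 1))"
proof -
  let ?M = "lebesgue_on \<Omega>"
  define V where "V = unit_ball_vol (real DIM('a))"
  have V: "0 \<le> V" by (simp add: V_def)
  define k where "k = \<delta> powr (\<tau> + DIM('a))"
  have k: "0 \<le> k" by (simp add: k_def)
  have \<Omega>m: "\<Omega> \<in> lmeasurable" using \<Omega> by (simp add: lmeasurable_open)
  interpret finite_measure ?M by (rule finite_measure_lebesgue_on[OF \<Omega>m])
  have [measurable]: "(\<lambda>z. ennreal (gagliardo_density s p u (fst z) (snd z))) \<in> borel_measurable (?M \<Otimes>\<^sub>M ?M)"
    using gagliardo_density_measurable[OF \<Omega>(1) cont u] by simp
  have swap: "(\<lambda>z. ennreal (gagliardo_density s p u (snd z) (fst z))) \<in> borel_measurable (?M \<Otimes>\<^sub>M ?M)"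
    by (rule measurable_compose[OF measurable_pair_swap'[unfolded case_prod_beta],
        of "\<lambda>z. ennreal (gagliardo_density s p u (fst z) (snd z))", simplified]) measurable
  have m_in: "(\<lambda>x. ennreal (gagliardo_density s p u x y)) \<in> borel_measurable ?M" if "y \<in> \<Omega>" for y
    using measurable_compose[OF measurable_Pair1'[of y ?M ?M] swap] that by simp
  have m_out: "(\<lambda>y. \<integral>\<^sup>+x. ennreal (gagliardo_density s p u x y) \<partial>?M) \<in> borel_measurable ?M"
    using swap by (intro borel_measurable_nn_integral) (simp add: case_prod_beta)
  have ball: "(\<integral>\<^sup>+x. indicator (ball y \<delta>) x \<partial>?M) \<le> ennreal (V * \<delta> ^ DIM('a))" for y
  proof -
    have "(\<integral>\<^sup>+x. indicator (ball y \<delta>) x \<partial>?M) = (\<integral>\<^sup>+x. indicator (ball y \<delta>) x * indicator \<Omega> x \<partial>lebesgue)"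
      using \<Omega>m by (subst nn_integral_restrict_space) auto
    also have "\<dots> \<le> (\<integral>\<^sup>+x. indicator (ball y \<delta>) x \<partial>lebesgue)"
      by (intro nn_integral_mono) (auto simp: indicator_def)
    also have "\<dots> = ennreal (V * \<delta> ^ DIM('a))"
      using \<delta> by (simp add: emeasure_ball V_def)
    finally show ?thesis .
  qed
  have inner: "(\<integral>\<^sup>+x. ennreal \<bar>u x - u y\<bar> * indicator (ball y \<delta>) x \<partial>?M)
      \<le> ennreal k * (ennreal V + (\<integral>\<^sup>+x. ennreal (gagliardo_density s p u x y) \<partial>?M))" if y: "y \<in> \<Omega>" for y
  proof -
    have "(\<integral>\<^sup>+x. ennreal \<bar>u x - u y\<bar> * indicator (ball y \<delta>) x \<partial>?M)
        \<le> (\<integral>\<^sup>+x. ennreal (\<delta> powr \<tau>) * indicator (ball y \<delta>) x + ennreal k * ennreal (gagliardo_density s p u x y) \<partial>?M)"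
    proof (rule nn_integral_mono)
      fix x assume "x \<in> space ?M"
      then have x: "x \<in> \<Omega>" by simp
      have "\<bar>u x - u y\<bar> \<le> \<delta> powr \<tau> + k * gagliardo_density s p u x y" if "x \<in> ball y \<delta>"
        unfolding k_def using that x y \<delta> \<tau> p[of "(x, y)"] s[of "(x, y)"]
        by (intro oscillation_le_gagliardo_density) (auto simp: dist_norm norm_minus_commute)
      moreover have "0 \<le> gagliardo_density s p u x y"
        by (simp add: gagliardo_density_def)
      ultimately show "ennreal \<bar>u x - u y\<bar> * indicator (ball y \<delta>) x
          \<le> ennreal (\<delta> powr \<tau>) * indicator (ball y \<delta>) x + ennreal k * ennreal (gagliardo_density s p u x y)"
        using k by (auto simp: indicator_def ennreal_leI simp flip: ennreal_mult ennreal_plus)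
    qed
    also have "\<dots> = ennreal (\<delta> powr \<tau>) * (\<integral>\<^sup>+x. indicator (ball y \<delta>) x \<partial>?M)
        + ennreal k * (\<integral>\<^sup>+x. ennreal (gagliardo_density s p u x y) \<partial>?M)"
    proof -
      have "(indicator (ball y \<delta>) :: 'a \<Rightarrow> ennreal) \<in> borel_measurable ?M"
        by (intro measurable_lebesgue_onI borel_measurable_indicator) simp
      then show ?thesis
        using m_in[OF y] by (simp add: nn_integral_add nn_integral_cmult)
    qed
    also have "\<dots> \<le> ennreal (\<delta> powr \<tau>) * ennreal (V * \<delta> ^ DIM('a))
        + ennreal k * (\<integral>\<^sup>+x. ennreal (gagliardo_density s p u x y) \<partial>?M)"
      by (intro add_right_mono mult_left_mono ball) auto
    also have "ennreal (\<delta> powr \<tau>) * ennreal (V * \<delta> ^ DIM('a)) = ennreal k * ennreal V"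
      using \<delta> V by (simp add: k_def powr_add powr_realpow mult_ac flip: ennreal_mult)
    finally show ?thesis by (simp add: distrib_left)
  qed
  have "(\<integral>\<^sup>+y. \<integral>\<^sup>+x. ennreal \<bar>u x - u y\<bar> * indicator (ball y \<delta>) x \<partial>?M \<partial>?M)
      \<le> (\<integral>\<^sup>+y. ennreal k * (ennreal V + (\<integral>\<^sup>+x. ennreal (gagliardo_density s p u x y) \<partial>?M)) \<partial>?M)"
    by (intro nn_integral_mono inner) simp
  also have "\<dots> = ennreal k * (ennreal V * emeasure ?M \<Omega>
      + (\<integral>\<^sup>+y. \<integral>\<^sup>+x. ennreal (gagliardo_density s p u x y) \<partial>?M \<partial>?M))"
    using m_out by (simp add: nn_integral_cmult nn_integral_add)
  also have "\<dots> \<le> ennreal k * (ennreal V * emeasure ?M \<Omega> + 1)"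
    by (intro mult_left_mono add_left_mono mod) auto
  also have "emeasure ?M \<Omega> = ennreal (measure lebesgue \<Omega>)"
    using \<Omega>m by (rule emeasure_lebesgue_on_self)
  also have "ennreal k * (ennreal V * ennreal (measure lebesgue \<Omega>) + 1) = ennreal (k * (V * measure lebesgue \<Omega> + 1))"
    using k V by (simp add: ennreal_mult)
  finally show ?thesis by (simp add: k_def V_def)
qed

lemma oscillation_on_ball_measurable:
  fixes \<Omega> :: "'a::euclidean_space set"
  assumes \<Omega>: "open \<Omega>" "bounded \<Omega>" and u [measurable]: "u \<in> borel_measurable (lebesgue_on \<Omega>)"
  shows "(\<lambda>y. \<integral>\<^sup>+x. ennreal \<bar>u x - u y\<bar> * indicator (ball y \<delta>) x \<partial>lebesgue_on \<Omega>)
      \<in> borel_measurable (lebesgue_on \<Omega>)"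
proof -
  let ?M = "lebesgue_on \<Omega>"
  interpret finite_measure ?M
    by (intro finite_measure_lebesgue_on lmeasurable_open \<Omega>)
  have [measurable]: "(\<lambda>z. dist (fst z) (snd z)) \<in> borel_measurable (?M \<Otimes>\<^sub>M ?M)"
    by (intro measurable_continuous_on_pair_lebesgue_on \<Omega>(1) continuous_intros)
  have "(\<lambda>z. ennreal \<bar>u (snd z) - u (fst z)\<bar> * (if dist (fst z) (snd z) < \<delta> then 1 else 0))
      \<in> borel_measurable (?M \<Otimes>\<^sub>M ?M)"
    by measurable
  also have "(\<lambda>z. ennreal \<bar>u (snd z) - u (fst z)\<bar> * (if dist (fst z) (snd z) < \<delta> then 1 else 0))
      = (\<lambda>(y, x). ennreal \<bar>u x - u y\<bar> * indicator (ball y \<delta>) x)"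
    by (auto simp: fun_eq_iff)
  finally show ?thesis
    by (rule borel_measurable_nn_integral)
qed

lemma abs_diff_average_le:
  fixes u :: "'b \<Rightarrow> real"
  assumes u: "integrable M u" and E: "E \<in> fmeasurable M" "0 < measure M E"
  shows "ennreal \<bar>c - (LINT x|M. indicator E x * u x) / measure M E\<bar>
      \<le> ennreal (1 / measure M E) * (\<integral>\<^sup>+x. ennreal \<bar>u x - c\<bar> * indicator E x \<partial>M)"
proof -
  have E': "E \<in> sets M" "emeasure M E < \<infinity>"
    using E by (auto simp: fmeasurable_def)
  have iE: "integrable M (\<lambda>x. indicator E x * c)"
    using E' by (intro integrable_mult_left) auto
  have iu: "integrable M (\<lambda>x. indicator E x * u x)"
    using integrable_mult_indicator[OF E'(1) u] by simp
  have "(LINT x|M. indicator E x * (c - u x)) = (LINT x|M. indicator E x * c - indicator E x * u x)"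
    by (simp add: right_diff_distrib)
  also have "\<dots> = (LINT x|M. indicator E x * c) - (LINT x|M. indicator E x * u x)"
    by (rule Bochner_Integration.integral_diff[OF iE iu])
  also have "(LINT x|M. indicator E x * c) = c * measure M E"
    using E' by simp
  finally have "c - (LINT x|M. indicator E x * u x) / measure M E
      = (LINT x|M. indicator E x * (c - u x)) / measure M E"
    using E by (simp add: diff_divide_distrib)
  then have "ennreal \<bar>c - (LINT x|M. indicator E x * u x) / measure M E\<bar>
      = ennreal (1 / measure M E) * ennreal (norm (LINT x|M. indicator E x * (c - u x)))"
    using E by (simp add: abs_divide flip: ennreal_mult)
  also have "ennreal (norm (LINT x|M. indicator E x * (c - u x)))
      \<le> (\<integral>\<^sup>+x. ennreal (norm (indicator E x * (c - u x))) \<partial>M)"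
    using iE iu by (intro integral_norm_bound_ennreal) (auto simp: right_diff_distrib)
  also have "(\<integral>\<^sup>+x. ennreal (norm (indicator E x * (c - u x))) \<partial>M)
      = (\<integral>\<^sup>+x. ennreal \<bar>u x - c\<bar> * indicator E x \<partial>M)"
    by (intro nn_integral_cong) (auto simp: indicator_def abs_minus_commute)
  finally show ?thesis by (simp add: mult_left_mono)
qed

section \<open>Subsequences converging almost everywhere\<close>

text \<open>
  For fixed \<open>m\<close> the approximants converge in \<open>L\<^sup>1\<close> by dominated convergence. As they are close to \<open>u n\<close>
  uniformly in \<open>n\<close>, the sequence \<open>u\<close> is Cauchy in \<open>L\<^sup>1\<close>, and therefore a subsequence converges almost
  everywhere.
\<close>

lemma L1_approximable_imp_AE_convergent_subseq:
  fixes u :: "nat \<Rightarrow> 'b \<Rightarrow> real" and A :: "nat \<Rightarrow> nat \<Rightarrow> 'b \<Rightarrow> real"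
  assumes "finite_measure M"
    and u [measurable]: "\<And>n. integrable M (u n)"
    and A [measurable]: "\<And>m n. A m n \<in> borel_measurable M"
    and A_bdd: "\<And>m n x. \<bar>A m n x\<bar> \<le> B m"
    and A_conv: "\<And>m x. convergent (\<lambda>n. A m n x)"
    and approx: "\<And>\<epsilon>::real. 0 < \<epsilon> \<Longrightarrow> \<exists>m. \<forall>n. (\<integral>\<^sup>+x. ennreal \<bar>u n x - A m n x\<bar> \<partial>M) \<le> ennreal \<epsilon>"
  obtains r v where "strict_mono r" "v \<in> borel_measurable M"
    "AE x in M. (\<lambda>n. u (r n) x) \<longlonglongrightarrow> v x"
proof -
  interpret finite_measure M by fact
  have A_int: "integrable M (A m n)" for m n
    using A_bdd by (intro integrable_const_bound[where B = "B m"]) auto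
  have "\<exists>N. \<forall>i\<ge>N. \<forall>j\<ge>N. LINT x|M. norm (u i x - u j x) < e" if e: "0 < e" for e :: real
  proof -
    obtain m where m: "\<And>n. (\<integral>\<^sup>+x. ennreal \<bar>u n x - A m n x\<bar> \<partial>M) \<le> ennreal (e / 4)"
      using approx[of "e / 4"] e by auto
    have close: "(LINT x|M. \<bar>u n x - A m n x\<bar>) \<le> e / 4" for n
    proof -
      have "ennreal (LINT x|M. \<bar>u n x - A m n x\<bar>) = (\<integral>\<^sup>+x. ennreal \<bar>u n x - A m n x\<bar> \<partial>M)"
        by (intro nn_integral_eq_integral[symmetric] integrable_abs Bochner_Integration.integrable_diff u A_int) auto
      then have "ennreal (LINT x|M. \<bar>u n x - A m n x\<bar>) \<le> ennreal (e / 4)"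
        using m[of n] by simp
      then show ?thesis
        using e by (subst (asm) ennreal_le_iff) auto
    qed
    define L where "L x = lim (\<lambda>n. A m n x)" for x
    have [measurable]: "L \<in> borel_measurable M"
      unfolding L_def by measurable
    have L: "(\<lambda>n. A m n x) \<longlonglongrightarrow> L x" for x
      using A_conv[of m x] by (simp add: L_def convergent_LIMSEQ_iff)
    have L_bdd: "\<bar>L x\<bar> \<le> B m" for x
      by (rule LIMSEQ_le_const2[OF tendsto_rabs[OF L]]) (use A_bdd in auto)
    have L_int: "integrable M L"
      using L_bdd by (intro integrable_const_bound[where B = "B m"]) auto
    have "(\<lambda>n. LINT x|M. \<bar>A m n x - L x\<bar>) \<longlonglongrightarrow> (LINT x|M. 0)"
    proof (rule integral_dominated_convergence[where w = "\<lambda>_. 2 * B m"])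
      show "AE x in M. (\<lambda>n. \<bar>A m n x - L x\<bar>) \<longlonglongrightarrow> 0"
        using L by (intro AE_I2 tendsto_rabs_zero) (simp add: LIM_zero)
      show "AE x in M. norm \<bar>A m n x - L x\<bar> \<le> 2 * B m" for n
      proof (rule AE_I2)
        show "norm \<bar>A m n x - L x\<bar> \<le> 2 * B m" for x
          using A_bdd[of m n x] L_bdd[of x] by simp
      qed
    qed auto
    then have "\<forall>\<^sub>F n in sequentially. (LINT x|M. \<bar>A m n x - L x\<bar>) < e / 4"
      using e by (intro order_tendstoD(2)[where a = "e/4"]) auto
    then obtain N where N: "\<And>n. n \<ge> N \<Longrightarrow> (LINT x|M. \<bar>A m n x - L x\<bar>) < e / 4"
      by (auto simp: eventually_sequentially)
    have "(LINT x|M. norm (u i x - u j x)) < e" if "N \<le> i" "N \<le> j" for i j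
    proof -
      have "(LINT x|M. norm (u i x - u j x))
          \<le> (LINT x|M. \<bar>u i x - A m i x\<bar> + \<bar>A m i x - L x\<bar> + (\<bar>A m j x - L x\<bar> + \<bar>u j x - A m j x\<bar>))"
        by (intro integral_mono integrable_norm Bochner_Integration.integrable_add integrable_abs
            Bochner_Integration.integrable_diff u A_int L_int) auto
      also have "\<dots> = (LINT x|M. \<bar>u i x - A m i x\<bar>) + (LINT x|M. \<bar>A m i x - L x\<bar>)
          + ((LINT x|M. \<bar>A m j x - L x\<bar>) + (LINT x|M. \<bar>u j x - A m j x\<bar>))"
        by (simp add: u A_int L_int)
      also have "\<dots> < e"
        using close[of i] close[of j] N[OF that(1)] N[OF that(2)] by simp
      finally show ?thesis .
    qed
    then show ?thesis by blast
  qed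
  from cauchy_L1_AE_cauchy_subseq[OF u this]
  obtain r where r: "strict_mono r" and C: "AE x in M. Cauchy (\<lambda>i. u (r i) x)"
    by blast
  show thesis
  proof (rule that[OF r])
    show "(\<lambda>x. lim (\<lambda>i. u (r i) x)) \<in> borel_measurable M"
      by (rule borel_measurable_lim_metric) auto
    show "AE x in M. (\<lambda>n. u (r n) x) \<longlonglongrightarrow> lim (\<lambda>i. u (r i) x)"
      using C by eventually_elim (simp add: Cauchy_convergent_iff convergent_LIMSEQ_iff)
  qed
qed

lemma ball_subset_in_borel: "{y. ball y e \<subseteq> \<Omega>} \<in> sets borel"
proof -
  have "{y. ball y e \<subseteq> \<Omega>} = (\<Inter>z\<in>-\<Omega>. {y. e \<le> dist y z})"
    by (auto simp: subset_iff not_less[symmetric])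
  moreover have "closed (\<Inter>z\<in>-\<Omega>. {y. e \<le> dist y z})"
    by (intro closed_INT ballI closed_Collect_le continuous_intros)
  ultimately show ?thesis by (simp add: borel_closed)
qed

lemma boundary_strip_in_sets:
  fixes \<Omega> :: "'a::euclidean_space set"
  shows "{y\<in>\<Omega>. \<not> ball y e \<subseteq> \<Omega>} \<in> sets (lebesgue_on \<Omega>)"
proof -
  have "{y\<in>\<Omega>. \<not> ball y e \<subseteq> \<Omega>} = \<Omega> \<inter> - {y. ball y e \<subseteq> \<Omega>}" by auto
  moreover have "- {y. ball y e \<subseteq> \<Omega>} \<in> sets lebesgue"
    by (intro sets_completionI_sets) (simp add: ball_subset_in_borel borel_comp)
  ultimately show ?thesis by (simp add: sets_restrict_space)
qed

lemma boundary_strip_measure_tendsto_zero: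
  fixes \<Omega> :: "'a::euclidean_space set"
  assumes \<Omega>: "open \<Omega>" "bounded \<Omega>"
    and \<delta>: "decseq \<delta>" "\<delta> \<longlonglongrightarrow> 0"
  shows "(\<lambda>m. measure (lebesgue_on \<Omega>) {y\<in>\<Omega>. \<not> ball y (\<delta> m) \<subseteq> \<Omega>}) \<longlonglongrightarrow> 0"
proof -
  interpret finite_measure "lebesgue_on \<Omega>"
    by (intro finite_measure_lebesgue_on lmeasurable_open \<Omega>)
  let ?S = "\<lambda>m. {y\<in>\<Omega>. \<not> ball y (\<delta> m) \<subseteq> \<Omega>}"
  have "decseq ?S"
  proof (rule decseq_SucI, rule subsetI)
    fix m y assume y: "y \<in> ?S (Suc m)"
    have "ball y (\<delta> (Suc m)) \<subseteq> ball y (\<delta> m)"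
      using decseq_SucD[OF \<delta>(1)] by (rule subset_ball)
    with y show "y \<in> ?S m" by auto
  qed
  then have "(\<lambda>m. measure (lebesgue_on \<Omega>) (?S m)) \<longlonglongrightarrow> measure (lebesgue_on \<Omega>) (\<Inter>m. ?S m)"
    by (intro finite_Lim_measure_decseq) (auto simp: boundary_strip_in_sets)
  moreover have "(\<Inter>m. ?S m) = {}"
  proof -
    have "\<exists>m. ball y (\<delta> m) \<subseteq> \<Omega>" if "y \<in> \<Omega>" for y
    proof -
      obtain e where e: "0 < e" "ball y e \<subseteq> \<Omega>"
        using \<Omega>(1) \<open>y \<in> \<Omega>\<close> open_contains_ball by blast
      have "\<forall>\<^sub>F m in sequentially. \<delta> m < e"
        using \<delta>(2) e(1) by (rule order_tendstoD)
      then obtain m where "\<delta> m < e"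
        by (auto simp: eventually_sequentially)
      then show ?thesis
        using e(2) by (meson order_trans subset_ball less_imp_le)
    qed
    then show ?thesis by auto
  qed
  ultimately show ?thesis by simp
qed

text \<open>
  A form of the Rellich--Kondrachov theorem with convergence almost everywhere. A function is approximated by its average over a
  ball of radius \<open>h\<close> containing the point, the centre being taken from a countable dense set: the first
  centre in a fixed enumeration that is closer than \<open>h\<close>. Compared with averages over the ball
  centred at the point itself, only countably many averages occur, so a diagonal subsequence makes all
  of them converge, and the approximants are trivially measurable in the point.

  At points where the ball of radius \<open>2 h\<close> leaves \<open>\<Omega>\<close>, the approximant is \<open>0\<close>. These points form a
  strip whose measure tends to zero with \<open>h\<close>, and on it the functions are small in \<open>L\<^sup>1\<close> uniformly,
  because \<open>\<integral> \<bar>u\<bar>\<^bsup>p\<^esup> \<le> 1\<close> with \<open>p \<ge> p0 > 1\<close>.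
\<close>

lemma sobolev_bounded_imp_AE_convergent_subseq:
  fixes \<Omega> :: "'a::euclidean_space set" and u :: "nat \<Rightarrow> 'a \<Rightarrow> real"
  assumes \<Omega>: "open \<Omega>" "bounded \<Omega>"
    and cont: "continuous_on (\<Omega> \<times> \<Omega>) s" "continuous_on (\<Omega> \<times> \<Omega>) p"
    and p: "\<And>z. z \<in> \<Omega> \<times> \<Omega> \<Longrightarrow> p0 \<le> p z" "1 < p0"
    and s: "\<And>z. z \<in> \<Omega> \<times> \<Omega> \<Longrightarrow> \<tau> \<le> s z" "0 < \<tau>"
    and u [measurable]: "\<And>n. u n \<in> borel_measurable (lebesgue_on \<Omega>)"
    and mod: "\<And>n. sobolev_modular \<Omega> s p (u n) \<le> 1"
  obtains r v where "strict_mono r" "v \<in> borel_measurable (lebesgue_on \<Omega>)"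
    "AE x in lebesgue_on \<Omega>. (\<lambda>n. u (r n) x) \<longlonglongrightarrow> v x"
proof -
  let ?M = "lebesgue_on \<Omega>"
  have \<Omega>m: "\<Omega> \<in> lmeasurable" using \<Omega> by (simp add: lmeasurable_open)
  interpret finite_measure ?M by (rule finite_measure_lebesgue_on[OF \<Omega>m])
  have mod_osc: "(\<integral>\<^sup>+y. \<integral>\<^sup>+x. ennreal (gagliardo_density s p (u n) x y) \<partial>?M \<partial>?M) \<le> 1" for n
    using mod[of n] unfolding sobolev_modular_def gagliardo_density_def
    by (rule order_trans[rotated]) simp
  have mod_p: "(\<integral>\<^sup>+x. ennreal (\<bar>u n x\<bar> powr p (x, x)) \<partial>?M) \<le> 1" for n
    using mod[of n] unfolding sobolev_modular_def
    by (rule order_trans[rotated]) simp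
  have [measurable]: "(\<lambda>x. p (x, x)) \<in> borel_measurable ?M"
    by (intro measurable_continuous_on_lebesgue_on \<Omega> continuous_on_compose2[OF cont(2)] continuous_intros) auto

  \<comment> \<open>Uniform integrability: the part of \<open>u n\<close> above \<open>T\<close> costs only a small multiple of the modular.\<close>
  have tail: "\<bar>u n x\<bar> \<le> T + T powr (1 - p0) * \<bar>u n x\<bar> powr p (x, x)"
    if "x \<in> \<Omega>" "1 \<le> T" for n x T
  proof -
    have px: "p0 \<le> p (x, x)" using p that by auto
    have "\<bar>u n x\<bar> \<le> min \<bar>u n x\<bar> T + T powr (1 - p (x, x)) * \<bar>u n x\<bar> powr p (x, x)"
      using powr_le_truncated_plus[of "\<bar>u n x\<bar>" T 1 "p (x, x)"] px p that by simp
    also have "\<dots> \<le> T + T powr (1 - p0) * \<bar>u n x\<bar> powr p (x, x)"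
      using px that by (intro add_mono mult_right_mono powr_mono) auto
    finally show ?thesis .
  qed
  define L where "L = measure lebesgue \<Omega> + 1"
  have M\<Omega>: "emeasure ?M \<Omega> = ennreal (measure lebesgue \<Omega>)"
    using \<Omega>m by (rule emeasure_lebesgue_on_self)
  have L1: "(\<integral>\<^sup>+x. ennreal \<bar>u n x\<bar> \<partial>?M) \<le> ennreal L" for n
  proof -
    have "(\<integral>\<^sup>+x. ennreal \<bar>u n x\<bar> \<partial>?M) \<le> (\<integral>\<^sup>+x. 1 + ennreal (\<bar>u n x\<bar> powr p (x, x)) \<partial>?M)"
    proof (rule nn_integral_mono)
      fix x assume "x \<in> space ?M"
      then show "ennreal \<bar>u n x\<bar> \<le> 1 + ennreal (\<bar>u n x\<bar> powr p (x, x))"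
        using tail[of x 1 n] by (simp flip: ennreal_1 ennreal_plus add: ennreal_leI)
    qed
    also have "\<dots> = emeasure ?M \<Omega> + (\<integral>\<^sup>+x. ennreal (\<bar>u n x\<bar> powr p (x, x)) \<partial>?M)"
      by (simp add: nn_integral_add)
    also have "\<dots> \<le> emeasure ?M \<Omega> + 1"
      by (intro add_left_mono mod_p)
    finally show ?thesis by (simp add: M\<Omega> L_def)
  qed
  have u_int: "integrable ?M (u n)" for n
    using L1[of n] by (intro integrableI_bounded) (auto simp: less_top[symmetric] top_unique)

  obtain D :: "'a set" where D: "countable D" "\<And>X. open X \<Longrightarrow> X \<noteq> {} \<Longrightarrow> \<exists>d\<in>D. d \<in> X"
    using countable_dense_exists by blast
  have "D \<noteq> {}" using D(2)[of UNIV] by auto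
  define d where "d = from_nat_into D"
  define \<delta> where "\<delta> m = 1 / real (Suc m)" for m
  define h where "h m = \<delta> m / 2" for m
  have \<delta>: "0 < \<delta> m" "\<delta> m \<le> 1" "0 < h m" for m by (auto simp: \<delta>_def h_def)
  have \<delta>_lim: "decseq \<delta>" "\<delta> \<longlonglongrightarrow> 0"
    using LIMSEQ_inverse_real_of_nat
    by (auto simp: \<delta>_def[abs_def] decseq_def field_simps inverse_eq_divide)
  define V where "V = unit_ball_vol (real DIM('a))"
  have V: "0 < V" by (simp add: V_def)
  define \<mu> where "\<mu> m = V * h m ^ DIM('a)" for m
  have \<mu>: "0 < \<mu> m" for m using V \<delta> by (simp add: \<mu>_def)
  define \<kappa> where "\<kappa> m y = (LEAST i. dist y (d i) < h m)" for m y
  have \<kappa>: "dist y (d (\<kappa> m y)) < h m" for m y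
  proof -
    have "\<exists>e\<in>D. e \<in> ball y (h m)" using \<delta>(3)[of m] by (intro D(2)) (auto simp: not_le)
    then obtain e where "e \<in> D" "dist y e < h m" by auto
    then obtain i where "dist y (d i) < h m"
      unfolding d_def using from_nat_into_surj[OF D(1)] by metis
    then show ?thesis unfolding \<kappa>_def by (rule LeastI)
  qed
  define b where "b n im = (LINT x|?M. indicator (ball (d (fst im)) (h (snd im))) x * u n x)"
    for n and im :: "nat \<times> nat"
  have ballM: "(indicator (ball y e) :: 'a \<Rightarrow> real) \<in> borel_measurable ?M" for y e
    by (intro measurable_lebesgue_onI borel_measurable_indicator) simp
  have b_bdd: "norm (b n im) \<le> L" for n im
  proof -
    have "(LINT x|?M. norm (u n x)) \<le> L"
    proof -
      have "ennreal (LINT x|?M. norm (u n x)) = (\<integral>\<^sup>+x. ennreal \<bar>u n x\<bar> \<partial>?M)"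
        by (subst nn_integral_eq_integral) (auto intro: u_int)
      then have "ennreal (LINT x|?M. norm (u n x)) \<le> ennreal L"
        using L1[of n] by simp
      then show ?thesis by (subst (asm) ennreal_le_iff) (auto simp: L_def)
    qed
    moreover have "norm (LINT x|?M. indicator (ball (d (fst im)) (h (snd im))) x * u n x)
        \<le> (LINT x|?M. norm (u n x))"
    proof (rule order_trans[OF integral_norm_bound], rule integral_mono)
      have "(\<lambda>x. indicator (ball (d (fst im)) (h (snd im))) x * u n x) \<in> borel_measurable ?M"
        by (intro borel_measurable_times ballM u)
      then have "integrable ?M (\<lambda>x. indicator (ball (d (fst im)) (h (snd im))) x * u n x)"
        by (rule Bochner_Integration.integrable_bound[OF u_int[of n]]) (auto simp: indicator_def)
      then show "integrable ?M (\<lambda>x. norm (indicator (ball (d (fst im)) (h (snd im))) x * u n x))"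
        by (rule integrable_norm)
    qed (auto intro: u_int simp: indicator_def)
    ultimately show ?thesis
      unfolding b_def by simp
  qed
  obtain k where k: "strict_mono (k :: nat \<Rightarrow> nat)" and b_conv: "\<And>im. \<exists>l. (\<lambda>n. b (k n) im) \<longlonglongrightarrow> l"
    using function_convergent_subsequence[of UNIV b L] b_bdd by auto
  define a where "a n im = b n im / \<mu> (snd im)" for n im
  have a_bdd: "norm (a n im) \<le> L / \<mu> (snd im)" for n im
    unfolding a_def using b_bdd[of n im] \<mu>[of "snd im"] by (simp add: divide_right_mono)
  have a_conv: "\<exists>l. (\<lambda>n. a (k n) im) \<longlonglongrightarrow> l" for im
  proof -
    obtain l where "(\<lambda>n. b (k n) im) \<longlonglongrightarrow> l" using b_conv by blast
    then have "(\<lambda>n. a (k n) im) \<longlonglongrightarrow> l / \<mu> (snd im)"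
      unfolding a_def using \<mu>[of "snd im"] by (intro tendsto_divide tendsto_const) auto
    then show ?thesis by blast
  qed
  define A where "A m n y = (if ball y (\<delta> m) \<subseteq> \<Omega> then a (k n) (\<kappa> m y, m) else 0)" for m n y

  have A_meas: "A m n \<in> borel_measurable ?M" for m n
  proof (rule measurable_lebesgue_onI)
    have [measurable]: "\<kappa> m \<in> borel \<rightarrow>\<^sub>M count_space UNIV"
      unfolding \<kappa>_def by measurable
    have [measurable]: "Measurable.pred borel (\<lambda>y. ball y (\<delta> m) \<subseteq> \<Omega>)"
      using ball_subset_in_borel by (simp add: pred_def)
    have [measurable]: "(\<lambda>y. a (k n) (\<kappa> m y, m)) \<in> borel_measurable borel"
      by (rule measurable_compose[of "\<kappa> m" _ "count_space UNIV" "\<lambda>i. a (k n) (i, m)"]) auto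
    show "A m n \<in> borel_measurable borel"
      unfolding A_def by measurable
  qed

  define osc where "osc m n y = (\<integral>\<^sup>+x. ennreal \<bar>u (k n) x - u (k n) y\<bar> * indicator (ball y (\<delta> m)) x \<partial>?M)"
    for m n y
  have osc_meas [measurable]: "osc m n \<in> borel_measurable ?M" for m n
    unfolding osc_def by (rule oscillation_on_ball_measurable[OF \<Omega> u])
  define S where "S m = {y\<in>\<Omega>. \<not> ball y (\<delta> m) \<subseteq> \<Omega>}" for m
  have S_meas [measurable]: "S m \<in> sets ?M" for m
    unfolding S_def by (rule boundary_strip_in_sets)
  \<comment> \<open>Off the strip the deviation from the average is an oscillation; on the strip it is \<open>u\<close> itself.\<close>
  have dev: "ennreal \<bar>u (k n) y - A m n y\<bar> \<le> ennreal (1 / \<mu> m) * osc m n y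
      + (ennreal T * indicator (S m) y + ennreal (T powr (1 - p0)) * ennreal (\<bar>u (k n) y\<bar> powr p (y, y)))"
    if y: "y \<in> \<Omega>" and T: "1 \<le> T" for m n y T
  proof (cases "ball y (\<delta> m) \<subseteq> \<Omega>")
    case True
    define E where "E = ball (d (\<kappa> m y)) (h m)"
    \<comment> \<open>The averaging ball lies in the ball around \<open>y\<close> of twice its radius, hence in \<open>\<Omega>\<close>.\<close>
    have E: "E \<subseteq> ball y (\<delta> m)"
    proof
      fix z assume "z \<in> E"
      then show "z \<in> ball y (\<delta> m)"
        using \<kappa>[of y m] dist_triangle[of y z "d (\<kappa> m y)"] by (simp add: E_def h_def dist_commute)
    qed
    have E\<Omega>: "E \<subseteq> \<Omega>" using E True by blast
    have "emeasure ?M E = ennreal (\<mu> m)"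
      using E\<Omega> \<Omega>m \<delta>(3)[of m]
      by (simp add: emeasure_restrict_space fmeasurable_def E_def emeasure_ball \<mu>_def V_def)
    then have E\<mu>: "measure ?M E = \<mu> m"
      using \<mu>[of m] by (simp add: measure_def)
    have "E \<in> sets ?M"
      using E\<Omega> \<Omega>m by (subst sets_restrict_space_iff) (auto simp: E_def fmeasurable_def)
    then have Efm: "E \<in> fmeasurable ?M" by (simp add: fmeasurable_eq_sets)
    have "ennreal \<bar>u (k n) y - A m n y\<bar>
        \<le> ennreal (1 / \<mu> m) * (\<integral>\<^sup>+x. ennreal \<bar>u (k n) x - u (k n) y\<bar> * indicator E x \<partial>?M)"
      using abs_diff_average_le[OF u_int[of "k n"] Efm, of "u (k n) y", unfolded E\<mu>, OF \<mu>] True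
      by (simp add: A_def a_def b_def E_def)
    also have "\<dots> \<le> ennreal (1 / \<mu> m) * osc m n y"
      unfolding osc_def using E by (intro mult_left_mono nn_integral_mono) (auto simp: indicator_def)
    finally show ?thesis by (rule order_trans) simp
  next
    case False
    then have "ennreal \<bar>u (k n) y - A m n y\<bar> \<le> ennreal (T + T powr (1 - p0) * \<bar>u (k n) y\<bar> powr p (y, y))"
      using tail[OF y T] by (simp add: A_def ennreal_leI)
    also have "\<dots> = ennreal T * indicator (S m) y + ennreal (T powr (1 - p0)) * ennreal (\<bar>u (k n) y\<bar> powr p (y, y))"
      using False y T by (simp add: S_def ennreal_mult)
    finally show ?thesis by (rule order_trans) simp
  qed
  have dev_int: "(\<integral>\<^sup>+y. ennreal \<bar>u (k n) y - A m n y\<bar> \<partial>?M)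
      \<le> ennreal (2 ^ DIM('a) / V * (V * measure lebesgue \<Omega> + 1) * \<delta> m powr \<tau>
          + T * measure ?M (S m) + T powr (1 - p0))" if T: "1 \<le> T" for m n T
  proof -
    have "(\<integral>\<^sup>+y. ennreal \<bar>u (k n) y - A m n y\<bar> \<partial>?M)
        \<le> (\<integral>\<^sup>+y. ennreal (1 / \<mu> m) * osc m n y + (ennreal T * indicator (S m) y
          + ennreal (T powr (1 - p0)) * ennreal (\<bar>u (k n) y\<bar> powr p (y, y))) \<partial>?M)"
      by (rule nn_integral_mono) (use dev T in simp)
    also have "\<dots> = ennreal (1 / \<mu> m) * (\<integral>\<^sup>+y. osc m n y \<partial>?M) + (ennreal T * emeasure ?M (S m)
        + ennreal (T powr (1 - p0)) * (\<integral>\<^sup>+y. ennreal (\<bar>u (k n) y\<bar> powr p (y, y)) \<partial>?M))"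
      by (simp add: nn_integral_add nn_integral_cmult)
    also have "\<dots> \<le> ennreal (1 / \<mu> m) * ennreal (\<delta> m powr (\<tau> + DIM('a)) * (V * measure lebesgue \<Omega> + 1))
        + (ennreal T * ennreal (measure ?M (S m)) + ennreal (T powr (1 - p0)) * 1)"
    proof (intro add_mono mult_left_mono mod_p)
      have "1 \<le> p z" if "z \<in> \<Omega> \<times> \<Omega>" for z using p(1)[OF that] p(2) by simp
      then show "(\<integral>\<^sup>+y. osc m n y \<partial>?M) \<le> ennreal (\<delta> m powr (\<tau> + DIM('a)) * (V * measure lebesgue \<Omega> + 1))"
        unfolding osc_def V_def
        by (intro nn_integral_oscillation_le[OF \<Omega> cont _ s(1,2) \<delta>(1,2) u mod_osc])
    qed (auto simp: emeasure_eq_measure)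
    also have "\<dots> = ennreal (1 / \<mu> m * (\<delta> m powr (\<tau> + DIM('a)) * (V * measure lebesgue \<Omega> + 1))
          + (T * measure ?M (S m) + T powr (1 - p0)))"
      using T V \<mu>[of m] by (simp add: ennreal_mult[symmetric] ennreal_plus[symmetric] del: ennreal_plus)
    also have "1 / \<mu> m * (\<delta> m powr (\<tau> + DIM('a)) * (V * measure lebesgue \<Omega> + 1))
        = 2 ^ DIM('a) / V * (V * measure lebesgue \<Omega> + 1) * \<delta> m powr \<tau>"
      using \<delta>[of m] V by (simp add: \<mu>_def h_def powr_add powr_realpow power_divide)
    finally show ?thesis by (simp add: add.assoc)
  qed
  have approx: "\<exists>m. \<forall>n. (\<integral>\<^sup>+x. ennreal \<bar>u (k n) x - A m n x\<bar> \<partial>?M) \<le> ennreal \<epsilon>" if \<epsilon>: "0 < \<epsilon>" for \<epsilon> :: real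
  proof -
    \<comment> \<open>First fix \<open>T\<close> to make the part above \<open>T\<close> small, then the scale \<open>m\<close>, which may depend on \<open>T\<close>.\<close>
    define T where "T = max 1 ((\<epsilon> / 2) powr (1 / (1 - p0)))"
    have T: "1 \<le> T" by (simp add: T_def)
    have "T powr (1 - p0) \<le> ((\<epsilon> / 2) powr (1 / (1 - p0))) powr (1 - p0)"
      using p \<epsilon> by (intro powr_mono2') (auto simp: T_def)
    then have T2: "T powr (1 - p0) \<le> \<epsilon> / 2"
      using p \<epsilon> by (simp add: powr_powr)
    have "(\<lambda>m. 2 ^ DIM('a) / V * (V * measure lebesgue \<Omega> + 1) * \<delta> m powr \<tau> + T * measure ?M (S m))
        \<longlonglongrightarrow> 2 ^ DIM('a) / V * (V * measure lebesgue \<Omega> + 1) * 0 + T * 0"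
    proof (intro tendsto_intros)
      show "(\<lambda>m. \<delta> m powr \<tau>) \<longlonglongrightarrow> 0"
        using \<delta>_lim \<delta>(1) s(2) by (intro tendsto_zero_powrI[OF _ tendsto_const]) (auto simp: less_imp_le)
      show "(\<lambda>m. measure ?M (S m)) \<longlonglongrightarrow> 0"
        unfolding S_def by (rule boundary_strip_measure_tendsto_zero[OF \<Omega> \<delta>_lim])
    qed
    then have "\<forall>\<^sub>F m in sequentially.
        2 ^ DIM('a) / V * (V * measure lebesgue \<Omega> + 1) * \<delta> m powr \<tau> + T * measure ?M (S m) < \<epsilon> / 2"
      using \<epsilon> by (intro order_tendstoD(2)[where a = "\<epsilon> / 2"]) auto
    then obtain m where
      m: "2 ^ DIM('a) / V * (V * measure lebesgue \<Omega> + 1) * \<delta> m powr \<tau> + T * measure ?M (S m) < \<epsilon> / 2"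
      by (auto simp: eventually_sequentially)
    have "(\<integral>\<^sup>+x. ennreal \<bar>u (k n) x - A m n x\<bar> \<partial>?M) \<le> ennreal \<epsilon>" for n
      by (rule order_trans[OF dev_int[OF T, of n m]], rule ennreal_leI) (use m T2 in linarith)
    then show ?thesis by blast
  qed
  have A_bdd: "\<bar>A m n x\<bar> \<le> L / \<mu> m" for m n x
    using a_bdd[of "k n" "(\<kappa> m x, m)"] \<mu>[of m] by (auto simp: A_def L_def)
  have A_conv: "convergent (\<lambda>n. A m n x)" for m x
    using a_conv[of "(\<kappa> m x, m)"]
    by (cases "ball x (\<delta> m) \<subseteq> \<Omega>") (auto simp: A_def convergent_def)
  obtain r v where "strict_mono r" "v \<in> borel_measurable ?M"
    "AE x in ?M. (\<lambda>n. u (k (r n)) x) \<longlonglongrightarrow> v x"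
    using L1_approximable_imp_AE_convergent_subseq[of ?M "\<lambda>n. u (k n)" A "\<lambda>m. L / \<mu> m",
        OF finite_measure_axioms u_int A_meas A_bdd A_conv approx] by metis
  then show thesis
    using that[OF strict_mono_o[OF k, of r], of v] by (simp add: comp_def)
qed

section \<open>Nakano spaces and Luxemburg norms\<close>

lemma luxemburg_norm_leI:
  assumes "0 < l" "(\<integral>\<^sup>+x. ennreal (\<bar>u x / l\<bar> powr q x) \<partial>lebesgue_on \<Omega>) \<le> 1"
  shows "luxemburg_norm \<Omega> q u \<le> ennreal l"
  unfolding luxemburg_norm_def using assms by (intro INF_lower) auto

lemma modular_le_1_if_luxemburg_norm_less:
  assumes "luxemburg_norm \<Omega> q u < ennreal L" "\<And>x. x \<in> \<Omega> \<Longrightarrow> 0 \<le> q x"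
  shows "(\<integral>\<^sup>+x. ennreal (\<bar>u x / L\<bar> powr q x) \<partial>lebesgue_on \<Omega>) \<le> 1"
proof -
  obtain l where l: "0 < l" "ennreal l < ennreal L"
    and int: "(\<integral>\<^sup>+x. ennreal (\<bar>u x / l\<bar> powr q x) \<partial>lebesgue_on \<Omega>) \<le> 1"
    using assms(1) unfolding luxemburg_norm_def INF_less_iff by auto
  have "l < L" using l by (simp add: ennreal_less_iff)
  then have "\<bar>u x / L\<bar> \<le> \<bar>u x / l\<bar>" for x
    using l by (simp add: abs_divide divide_left_mono)
  then have "(\<integral>\<^sup>+x. ennreal (\<bar>u x / L\<bar> powr q x) \<partial>lebesgue_on \<Omega>)
      \<le> (\<integral>\<^sup>+x. ennreal (\<bar>u x / l\<bar> powr q x) \<partial>lebesgue_on \<Omega>)"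
    using assms(2) by (intro nn_integral_mono ennreal_leI powr_mono2) auto
  with int show ?thesis by (rule order_trans[rotated])
qed

lemma sobolev_modular_le_1_if_sobolev_norm_less:
  assumes "sobolev_norm \<Omega> s p u < ennreal L" "\<And>z. z \<in> \<Omega> \<times> \<Omega> \<Longrightarrow> 0 \<le> p z"
  shows "sobolev_modular \<Omega> s p (\<lambda>x. u x / L) \<le> 1"
proof -
  obtain l where l: "0 < l" "ennreal l < ennreal L"
    and mod: "sobolev_modular \<Omega> s p (\<lambda>x. u x / l) < 1"
    using assms(1) unfolding sobolev_norm_def INF_less_iff by auto
  have "l < L" using l by (simp add: ennreal_less_iff)
  then have le: "\<bar>t / L\<bar> \<le> \<bar>t / l\<bar>" for t
    using l by (simp add: abs_divide divide_left_mono)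
  have "sobolev_modular \<Omega> s p (\<lambda>x. u x / L) \<le> sobolev_modular \<Omega> s p (\<lambda>x. u x / l)"
    unfolding sobolev_modular_def
    using assms(2) le le[of "u _ - u _"]
    by (intro add_mono nn_integral_mono ennreal_leI divide_right_mono powr_mono2)
      (auto simp: diff_divide_distrib)
  with mod show ?thesis by simp
qed

text \<open>
  If the \<open>r\<close>-modular of \<open>u / l\<close> is at most \<open>1\<close>, its \<open>q\<close>-modular is at most \<open>A = 1 + \<bar>\<Omega>\<bar>\<close>, and
  dividing by \<open>A \<ge> 1\<close> once more reduces it to \<open>1\<close> since \<open>q \<ge> 1\<close>.
\<close>

lemma luxemburg_norm_mono_exponent:
  assumes \<Omega>: "\<Omega> \<in> lmeasurable"
    and [measurable]: "u \<in> borel_measurable (lebesgue_on \<Omega>)" "r \<in> borel_measurable (lebesgue_on \<Omega>)"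
    and q: "\<And>x. x \<in> \<Omega> \<Longrightarrow> 1 \<le> q x \<and> q x \<le> r x"
  shows "luxemburg_norm \<Omega> q u \<le> ennreal (1 + measure lebesgue \<Omega>) * luxemburg_norm \<Omega> r u"
proof -
  let ?M = "lebesgue_on \<Omega>"
  define A where "A = 1 + measure lebesgue \<Omega>"
  have A: "1 \<le> A" by (simp add: A_def)
  have "luxemburg_norm \<Omega> q u \<le> ennreal A * ennreal l"
    if l: "0 < l" and int: "(\<integral>\<^sup>+x. ennreal (\<bar>u x / l\<bar> powr r x) \<partial>?M) \<le> 1" for l
  proof -
    have pw: "\<bar>u x / (A * l)\<bar> powr q x \<le> (1 / A) * (1 + \<bar>u x / l\<bar> powr r x)" if x: "x \<in> \<Omega>" for x
    proof -
      define t where "t = \<bar>u x / l\<bar>"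
      have t: "0 \<le> t" by (simp add: t_def)
      have "\<bar>u x / (A * l)\<bar> = t / A" using A by (simp add: t_def abs_mult)
      then have "\<bar>u x / (A * l)\<bar> powr q x = (t / A) powr q x" by (simp only:)
      also have "\<dots> = A powr - q x * t powr q x"
        using A t by (simp add: powr_divide powr_minus field_simps)
      also have "\<dots> \<le> (1 / A) * (1 + t powr r x)"
      proof (rule mult_mono)
        have "A powr - q x \<le> A powr - 1"
          using A q[OF x] by (intro powr_mono) auto
        then show "A powr - q x \<le> 1 / A"
          using A by (simp add: powr_minus_divide)
        show "t powr q x \<le> 1 + t powr r x"
          using q[OF x] t by (intro powr_le_one_plus_powr) auto
      qed (use A in auto)
      finally show ?thesis by (simp add: t_def)
    qed
    have "(\<integral>\<^sup>+x. ennreal (\<bar>u x / (A * l)\<bar> powr q x) \<partial>?M)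
        \<le> (\<integral>\<^sup>+x. ennreal (1 / A) * (1 + ennreal (\<bar>u x / l\<bar> powr r x)) \<partial>?M)"
    proof (rule nn_integral_mono)
      fix x assume "x \<in> space ?M"
      then have "ennreal (\<bar>u x / (A * l)\<bar> powr q x) \<le> ennreal ((1 / A) * (1 + \<bar>u x / l\<bar> powr r x))"
        using pw[of x] by (intro ennreal_leI) auto
      also have "\<dots> = ennreal (1 / A) * (1 + ennreal (\<bar>u x / l\<bar> powr r x))"
        using A by (subst ennreal_mult) auto
      finally show "ennreal (\<bar>u x / (A * l)\<bar> powr q x)
        \<le> ennreal (1 / A) * (1 + ennreal (\<bar>u x / l\<bar> powr r x))" .
    qed
    also have "\<dots> = ennreal (1 / A) * (emeasure ?M \<Omega> + (\<integral>\<^sup>+x. ennreal (\<bar>u x / l\<bar> powr r x) \<partial>?M))"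
      by (simp add: nn_integral_cmult nn_integral_add)
    also have "\<dots> \<le> ennreal (1 / A) * (emeasure ?M \<Omega> + 1)"
      by (intro mult_left_mono add_left_mono int) auto
    also have "emeasure ?M \<Omega> + 1 = ennreal A"
      using \<Omega> by (simp add: emeasure_lebesgue_on_self A_def)
    also have "ennreal (1 / A) * ennreal A = 1"
      using A by (simp flip: ennreal_mult)
    finally have "luxemburg_norm \<Omega> q u \<le> ennreal (A * l)"
      using A l by (intro luxemburg_norm_leI) auto
    then show ?thesis
      using A l by (simp add: ennreal_mult)
  qed
  then have "luxemburg_norm \<Omega> q u / ennreal A \<le> luxemburg_norm \<Omega> r u"
    unfolding luxemburg_norm_def[of \<Omega> r]
    using A by (intro INF_greatest) (auto simp: divide_le_posI_ennreal)
  then have "ennreal A * (luxemburg_norm \<Omega> q u / ennreal A) \<le> ennreal A * luxemburg_norm \<Omega> r u"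
    by (rule mult_left_mono) simp
  moreover have "ennreal A * (luxemburg_norm \<Omega> q u / ennreal A) = luxemburg_norm \<Omega> q u"
    using A mult_divide_eq_ennreal[of "ennreal A" "luxemburg_norm \<Omega> q u"]
    by (simp add: ennreal_times_divide mult.commute)
  ultimately show ?thesis by (simp add: A_def)
qed

lemma nakano_space_mono_exponent:
  assumes \<Omega>: "\<Omega> \<in> lmeasurable"
    and [measurable]: "r \<in> borel_measurable (lebesgue_on \<Omega>)"
    and q: "\<And>x. x \<in> \<Omega> \<Longrightarrow> 0 \<le> q x \<and> q x \<le> r x"
  shows "nakano_space \<Omega> r \<subseteq> nakano_space \<Omega> q"
proof
  let ?M = "lebesgue_on \<Omega>"
  fix u assume "u \<in> nakano_space \<Omega> r"
  then have [measurable]: "u \<in> borel_measurable ?M" and fin: "(\<integral>\<^sup>+x. ennreal (\<bar>u x\<bar> powr r x) \<partial>?M) < \<infinity>"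
    by (auto simp: nakano_space_def)
  have "(\<integral>\<^sup>+x. ennreal (\<bar>u x\<bar> powr q x) \<partial>?M) \<le> (\<integral>\<^sup>+x. 1 + ennreal (\<bar>u x\<bar> powr r x) \<partial>?M)"
    using q powr_le_one_plus_powr
    by (intro nn_integral_mono) (auto simp: ennreal_leI simp flip: ennreal_plus ennreal_1)
  also have "\<dots> = emeasure ?M \<Omega> + (\<integral>\<^sup>+x. ennreal (\<bar>u x\<bar> powr r x) \<partial>?M)"
    by (simp add: nn_integral_add)
  also have "\<dots> < \<infinity>"
    using fin unfolding emeasure_lebesgue_on_self[OF \<Omega>] by simp
  finally show "u \<in> nakano_space \<Omega> q" by (simp add: nakano_space_def)
qed

lemma luxemburg_norm_tendsto_zero:
  fixes f :: "nat \<Rightarrow> 'a::euclidean_space \<Rightarrow> real"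
  assumes f: "\<And>n. f n \<in> borel_measurable (lebesgue_on \<Omega>)" "q \<in> borel_measurable (lebesgue_on \<Omega>)"
    and q: "\<And>x. x \<in> \<Omega> \<Longrightarrow> 0 \<le> q x \<and> q x \<le> Q"
    and lim: "(\<lambda>n. \<integral>\<^sup>+x. ennreal (\<bar>f n x\<bar> powr q x) \<partial>lebesgue_on \<Omega>) \<longlonglongrightarrow> 0"
  shows "(\<lambda>n. luxemburg_norm \<Omega> q (\<lambda>x. c * f n x)) \<longlonglongrightarrow> 0"
proof (rule tendsto_zero_ennreal)
  let ?M = "lebesgue_on \<Omega>"
  fix \<epsilon> :: real assume \<epsilon>: "0 < \<epsilon>"
  define a where "a = c / (\<epsilon> / 2)"
  have "(\<lambda>n. ennreal (max 1 \<bar>a\<bar> powr Q) * (\<integral>\<^sup>+x. ennreal (\<bar>f n x\<bar> powr q x) \<partial>?M))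
      \<longlonglongrightarrow> ennreal (max 1 \<bar>a\<bar> powr Q) * 0"
    by (intro ennreal_tendsto_cmult lim) simp
  then have "\<forall>\<^sub>F n in sequentially.
      ennreal (max 1 \<bar>a\<bar> powr Q) * (\<integral>\<^sup>+x. ennreal (\<bar>f n x\<bar> powr q x) \<partial>?M) < 1"
    by (rule order_tendstoD) simp
  then show "\<forall>\<^sub>F n in sequentially. luxemburg_norm \<Omega> q (\<lambda>x. c * f n x) < ennreal \<epsilon>"
  proof eventually_elim
    case (elim n)
    have "(\<integral>\<^sup>+x. ennreal (\<bar>a * f n x\<bar> powr q x) \<partial>?M)
        \<le> ennreal (max 1 \<bar>a\<bar> powr Q) * (\<integral>\<^sup>+x. ennreal (\<bar>f n x\<bar> powr q x) \<partial>?M)"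
      using f q by (intro nn_integral_powr_scale_le) auto
    moreover have "c * f n x / (\<epsilon> / 2) = a * f n x" for x
      by (simp add: a_def)
    ultimately have "(\<integral>\<^sup>+x. ennreal (\<bar>c * f n x / (\<epsilon> / 2)\<bar> powr q x) \<partial>?M) \<le> 1"
      using elim by (simp only:)
    then have "luxemburg_norm \<Omega> q (\<lambda>x. c * f n x) \<le> ennreal (\<epsilon> / 2)"
      using \<epsilon> by (intro luxemburg_norm_leI) auto
    also have "\<dots> < ennreal \<epsilon>"
      using \<epsilon> by (intro ennreal_lessI) auto
    finally show ?case .
  qed
qed

section \<open>The compact embedding\<close>

lemma compact_bounds:
  fixes f :: "'b::topological_space \<Rightarrow> real"
  assumes "compact K" "continuous_on K f" "x \<in> K"
  shows "(INF z\<in>K. f z) \<le> f x" "f x \<le> (SUP z\<in>K. f z)"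
  using assms compact_continuous_image[OF assms(2,1)]
  by (auto intro!: cINF_lower cSUP_upper bounded_imp_bdd_below bounded_imp_bdd_above compact_imp_bounded)

lemma critical_exponent_continuous:
  fixes s p :: "'a::euclidean_space \<times> 'a \<Rightarrow> real"
  assumes "continuous_on (K \<times> K) s" "continuous_on (K \<times> K) p"
    and "\<And>x. x \<in> K \<Longrightarrow> p (x, x) * s (x, x) < DIM('a)"
  shows "continuous_on K (critical_exponent s p)"
proof -
  have "continuous_on K (\<lambda>x. p (x, x))" "continuous_on K (\<lambda>x. s (x, x))"
    by (auto intro!: continuous_on_compose2[OF assms(1)] continuous_on_compose2[OF assms(2)]
        continuous_intros)
  then show ?thesis
    unfolding critical_exponent_def using assms(3) by (intro continuous_intros) force+
qed

theorem theorem3: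
  fixes \<Omega> :: "'a::euclidean_space set"
    and s p :: "'a \<times> 'a \<Rightarrow> real"
    and q :: "'a \<Rightarrow> real"
    and x0 :: 'a
    and \<beta> C0 \<eta> :: real
  assumes "bounded_lipschitz_domain \<Omega>"
    and "log_holder_on (closure \<Omega> \<times> closure \<Omega>) s" "symmetric_on (closure \<Omega>) s"
    and "log_holder_on (closure \<Omega> \<times> closure \<Omega>) p" "symmetric_on (closure \<Omega>) p"
    and "0 < (INF z\<in>closure \<Omega> \<times> closure \<Omega>. s z)"
    and "(INF z\<in>closure \<Omega> \<times> closure \<Omega>. s z) \<le> (SUP z\<in>closure \<Omega> \<times> closure \<Omega>. s z)"
    and "(SUP z\<in>closure \<Omega> \<times> closure \<Omega>. s z) < 1"
    and "1 < (INF z\<in>closure \<Omega> \<times> closure \<Omega>. p z)"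
    and "(INF z\<in>closure \<Omega> \<times> closure \<Omega>. p z) \<le> (SUP z\<in>closure \<Omega> \<times> closure \<Omega>. p z)"
    and "(SUP z\<in>closure \<Omega> \<times> closure \<Omega>. p z)
           < real DIM('a) / (SUP z\<in>closure \<Omega> \<times> closure \<Omega>. s z)"
    and "continuous_on (closure \<Omega>) q"
    and "(SUP z\<in>closure \<Omega> \<times> closure \<Omega>. p z) \<le> (INF x\<in>closure \<Omega>. q x)"
    and "\<forall>x\<in>\<Omega>. (INF x\<in>closure \<Omega>. q x) \<le> q x \<and> q x \<le> critical_exponent s p x"
    and "continuous_embedding (sobolev_space \<Omega> s p) (sobolev_norm \<Omega> s p)
           (nakano_space \<Omega> (critical_exponent s p)) (luxemburg_norm \<Omega> (critical_exponent s p))"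
    and "x0 \<in> \<Omega>" "0 < \<beta>" "\<beta> < 1" "0 < C0" "0 < \<eta>" "\<eta> \<le> 1" "ball x0 \<eta> \<subseteq> \<Omega>"
    and "\<forall>\<rho>. 0 < \<rho> \<and> \<rho> < \<eta> \<longrightarrow>
           (SUP x\<in>frontier (ball x0 \<rho>). q x)
             \<le> (INF x\<in>frontier (ball x0 \<rho>). critical_exponent s p x) - C0 / (- ln \<rho>) powr \<beta>"
    \<comment> \<open>taken in the extended reals, so that the infimum is \<open>\<infinity>\<close> if \<open>\<Omega>\<close> is the ball itself\<close>
    and "0 < (INF x\<in>\<Omega> - ball x0 \<eta>. ereal (critical_exponent s p x - q x))"
  shows "compact_embedding (sobolev_space \<Omega> s p) (sobolev_norm \<Omega> s p)
           (nakano_space \<Omega> q) (luxemburg_norm \<Omega> q)"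
proof -
  let ?M = "lebesgue_on \<Omega>" and ?K = "closure \<Omega>" and ?r = "critical_exponent s p"
  note hyps = assms
  have \<Omega>: "open \<Omega>" "bounded \<Omega>"
    using hyps(1) by (auto simp: bounded_lipschitz_domain_def)
  have \<Omega>m: "\<Omega> \<in> lmeasurable" using \<Omega> by (simp add: lmeasurable_open)
  interpret finite_measure ?M by (rule finite_measure_lebesgue_on[OF \<Omega>m])
  have sub: "\<Omega> \<subseteq> ?K" by (rule closure_subset)
  have K: "compact ?K" using \<Omega>(2) by simp
  have KK: "compact (?K \<times> ?K)" using K by (rule compact_Times[OF K])
  have cs: "continuous_on (?K \<times> ?K) s" and cp: "continuous_on (?K \<times> ?K) p"
    using hyps(2,4) by (auto simp: log_holder_on_def)
  have cq: "continuous_on ?K q" by (rule hyps(12))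
  define sm where "sm = (INF z\<in>?K \<times> ?K. s z)"
  define sp where "sp = (SUP z\<in>?K \<times> ?K. s z)"
  define pm where "pm = (INF z\<in>?K \<times> ?K. p z)"
  define pp where "pp = (SUP z\<in>?K \<times> ?K. p z)"
  have sb: "sm \<le> s z" "s z \<le> sp" and pb: "pm \<le> p z" "p z \<le> pp" if "z \<in> ?K \<times> ?K" for z
    using compact_bounds[OF KK cs that] compact_bounds[OF KK cp that]
    by (auto simp: sm_def sp_def pm_def pp_def)
  have cst: "0 < sm" "sm \<le> sp" "1 < pm" "pm \<le> pp" "pp < DIM('a) / sp"
    using hyps(6,7,9,10,11) by (auto simp: sm_def sp_def pm_def pp_def)
  have "p (x, x) * s (x, x) < DIM('a)" if "x \<in> ?K" for x
  proof -
    have "p (x, x) * s (x, x) \<le> pp * sp"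
      using sb[of "(x, x)"] pb[of "(x, x)"] that cst by (intro mult_mono) auto
    also have "\<dots> < DIM('a)"
      using cst by (simp add: pos_less_divide_eq)
    finally show ?thesis .
  qed
  then have cr: "continuous_on ?K ?r"
    by (rule critical_exponent_continuous[OF cs cp])
  define R where "R = (SUP x\<in>?K. ?r x)"
  define Q where "Q = (SUP x\<in>?K. q x)"
  have rR: "?r x \<le> R" and qQ: "q x \<le> Q" if "x \<in> \<Omega>" for x
    using compact_bounds(2)[OF K cr] compact_bounds(2)[OF K cq] sub that by (auto simp: R_def Q_def)
  have qr: "1 < q x" "q x \<le> ?r x" if x: "x \<in> \<Omega>" for x
  proof -
    have "pp \<le> q x"
      using hyps(13,14) x by (force simp: pp_def)
    then show "1 < q x" using cst by simp
    show "q x \<le> ?r x" using hyps(14) x by auto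
  qed
  have Q: "0 < Q" using qQ[OF \<open>x0 \<in> \<Omega>\<close>] qr(1)[OF \<open>x0 \<in> \<Omega>\<close>] by simp
  have q0: "0 \<le> q x" if "x \<in> \<Omega>" for x using qr(1)[OF that] by simp
  have r0: "0 < ?r x" if "x \<in> \<Omega>" for x using qr[OF that] by simp
  have [measurable]: "q \<in> borel_measurable ?M" "?r \<in> borel_measurable ?M"
    using cq cr sub \<Omega> by (auto intro!: measurable_continuous_on_lebesgue_on intro: continuous_on_subset)

  \<comment> \<open>Each point is compared with the supremum and the infimum over the sphere around \<open>x0\<close> on which it lies.\<close>
  have near: "C0 / (- ln (dist x x0)) powr \<beta> \<le> ?r x - q x"
    if x: "x \<in> \<Omega>" "0 < dist x x0" "dist x x0 < \<eta>" for x
  proof -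
    define \<rho> where "\<rho> = dist x x0"
    let ?S = "frontier (ball x0 \<rho>)"
    have \<rho>: "0 < \<rho>" "\<rho> < \<eta>" using x by (auto simp: \<rho>_def)
    have S: "?S = sphere x0 \<rho>" using \<rho> by simp
    have xS: "x \<in> ?S" unfolding S by (simp add: \<rho>_def dist_commute)
    have "?S \<subseteq> ball x0 \<eta>" using \<rho> by (auto simp: S)
    then have SK: "?S \<subseteq> ?K" using hyps(22) sub by blast
    have cS: "compact ?S" by (simp add: S)
    have "q x \<le> (SUP x\<in>?S. q x)"
      by (rule compact_bounds(2)[OF cS continuous_on_subset[OF cq SK] xS])
    moreover have "(INF x\<in>?S. ?r x) \<le> ?r x"
      by (rule compact_bounds(1)[OF cS continuous_on_subset[OF cr SK] xS])
    moreover have "(SUP x\<in>?S. q x) \<le> (INF x\<in>?S. ?r x) - C0 / (- ln \<rho>) powr \<beta>"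
      using hyps(23) \<rho> by blast
    ultimately show ?thesis by (simp add: \<rho>_def)
  qed
  obtain c where c: "0 < c" and far: "\<And>x. x \<in> \<Omega> \<Longrightarrow> \<eta> \<le> dist x x0 \<Longrightarrow> c \<le> ?r x - q x"
  proof -
    \<comment> \<open>The infimum may be infinite, so a number strictly below it is taken.\<close>
    obtain e where e: "0 < e" "e < (INF x\<in>\<Omega> - ball x0 \<eta>. ereal (?r x - q x))"
      using hyps(24) dense by blast
    obtain c where ec: "e = ereal c"
      using e by (cases e) auto
    have "c \<le> ?r x - q x" if "x \<in> \<Omega>" "\<eta> \<le> dist x x0" for x
    proof -
      have "e < ereal (?r x - q x)"
        using that by (intro less_le_trans[OF e(2)] INF_lower) (auto simp: dist_commute)
      then show ?thesis by (simp add: ec)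
    qed
    then show thesis using that[of c] e ec by simp
  qed
  note threshold = logarithmic_gap_integrable_threshold[OF \<Omega> hyps(19,17,18,20,21) c qQ Q near far]

  let ?V = "sobolev_space \<Omega> s p" and ?n = "sobolev_norm \<Omega> s p"
  obtain C where C: "0 < C" and emb: "?V \<subseteq> nakano_space \<Omega> ?r"
    and embC: "\<And>u. u \<in> ?V \<Longrightarrow> luxemburg_norm \<Omega> ?r u \<le> ennreal C * ?n u"
    using hyps(15) by (auto simp: continuous_embedding_def)
  define A where "A = 1 + measure lebesgue \<Omega>"
  have A: "1 \<le> A" by (simp add: A_def)
  have V_meas: "u \<in> borel_measurable ?M" if "u \<in> ?V" for u
    using that by (auto simp: sobolev_space_def nakano_space_def)
  have nakano_mono: "nakano_space \<Omega> ?r \<subseteq> nakano_space \<Omega> q"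
    using qr q0 by (intro nakano_space_mono_exponent \<Omega>m) (auto simp: less_imp_le)
  have "continuous_embedding ?V ?n (nakano_space \<Omega> q) (luxemburg_norm \<Omega> q)"
    unfolding continuous_embedding_def
  proof (intro conjI exI[of _ "A * C"] ballI)
    show "?V \<subseteq> nakano_space \<Omega> q" using emb nakano_mono by blast
    show "0 < A * C" using A C by simp
    fix u assume u: "u \<in> ?V"
    have "luxemburg_norm \<Omega> q u \<le> ennreal A * luxemburg_norm \<Omega> ?r u"
      unfolding A_def using qr V_meas[OF u] by (intro luxemburg_norm_mono_exponent \<Omega>m) (auto simp: less_imp_le)
    also have "\<dots> \<le> ennreal A * (ennreal C * ?n u)"
      by (intro mult_left_mono embC u) simp
    finally show "luxemburg_norm \<Omega> q u \<le> ennreal (A * C) * ?n u"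
      using A C by (simp add: ennreal_mult mult.assoc)
  qed
  moreover have "\<exists>v\<in>nakano_space \<Omega> q. \<exists>k::nat \<Rightarrow> nat. strict_mono k \<and>
      (\<lambda>n. luxemburg_norm \<Omega> q (\<lambda>x. u (k n) x - v x)) \<longlonglongrightarrow> 0"
    if uV: "\<And>n. u n \<in> ?V" and bdd: "\<And>n. ?n (u n) \<le> ennreal B" for u :: "nat \<Rightarrow> 'a \<Rightarrow> real" and B
  proof -
    \<comment> \<open>A common scale above the bounds on the Sobolev and on the critical norms makes both modulars at most \<open>1\<close>.\<close>
    define L where "L = (C + 1) * \<bar>B\<bar> + 1"
    have L: "0 < L" using C by (simp add: L_def add_nonneg_pos)
    have BL: "\<bar>B\<bar> < L" "C * \<bar>B\<bar> < L"
      using C by (auto simp: L_def distrib_right add_strict_increasing2)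
    define w where "w n x = u n x / L" for n x
    have w_meas [measurable]: "w n \<in> borel_measurable ?M" for n
      using V_meas[OF uV] unfolding w_def by simp
    have nB: "?n (u n) \<le> ennreal \<bar>B\<bar>" for n
      using bdd[of n] by (rule order_trans) (simp add: ennreal_leI)
    have w_mod: "sobolev_modular \<Omega> s p (w n) \<le> 1" for n
      unfolding w_def
    proof (rule sobolev_modular_le_1_if_sobolev_norm_less)
      show "?n (u n) < ennreal L"
        using nB[of n] BL(1) L by (meson ennreal_lessI le_less_trans)
      show "0 \<le> p z" if "z \<in> \<Omega> \<times> \<Omega>" for z
      proof -
        have "pm \<le> p z" by (rule pb(1)) (use that sub in auto)
        with cst show ?thesis by simp
      qed
    qed
    have w_r: "(\<integral>\<^sup>+x. ennreal (\<bar>w n x\<bar> powr ?r x) \<partial>?M) \<le> 1" for n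
      unfolding w_def
    proof (rule modular_le_1_if_luxemburg_norm_less)
      have "luxemburg_norm \<Omega> ?r (u n) \<le> ennreal C * ennreal \<bar>B\<bar>"
        by (rule order_trans[OF embC[OF uV]], intro mult_left_mono nB) simp
      also have "\<dots> < ennreal L"
        using C BL(2) L by (simp add: ennreal_lessI flip: ennreal_mult)
      finally show "luxemburg_norm \<Omega> ?r (u n) < ennreal L" .
    qed (use r0 in \<open>simp add: less_imp_le\<close>)
    have sub2: "\<Omega> \<times> \<Omega> \<subseteq> ?K \<times> ?K" using sub by blast
    have pb\<Omega>: "pm \<le> p z" and sb\<Omega>: "sm \<le> s z" if "z \<in> \<Omega> \<times> \<Omega>" for z
      using pb(1) sb(1) that sub2 by blast+
    obtain k v where k: "strict_mono k" and v [measurable]: "v \<in> borel_measurable ?M"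
      and lim: "AE x in ?M. (\<lambda>n. w (k n) x) \<longlonglongrightarrow> v x"
      by (rule sobolev_bounded_imp_AE_convergent_subseq[OF \<Omega> continuous_on_subset[OF cs sub2]
            continuous_on_subset[OF cp sub2] pb\<Omega> cst(3) sb\<Omega> cst(1) w_meas w_mod])
    \<comment> \<open>The critical modular is lower semicontinuous, and a bound on it also places the limit in the space of \<open>q\<close>.\<close>
    have v_r: "(\<integral>\<^sup>+x. ennreal (\<bar>v x\<bar> powr ?r x) \<partial>?M) \<le> 1"
      by (rule nn_integral_powr_Fatou[OF w_meas _ _ lim w_r]) (use r0 in simp_all)
    have diff_r: "(\<integral>\<^sup>+x. ennreal (\<bar>w (k n) x - v x\<bar> powr ?r x) \<partial>?M) \<le> ennreal (2 powr R * 2)" for n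
    proof -
      have "(\<integral>\<^sup>+x. ennreal (\<bar>w (k n) x - v x\<bar> powr ?r x) \<partial>?M)
          \<le> ennreal (2 powr R) * ((\<integral>\<^sup>+x. ennreal (\<bar>w (k n) x\<bar> powr ?r x) \<partial>?M)
            + (\<integral>\<^sup>+x. ennreal (\<bar>v x\<bar> powr ?r x) \<partial>?M))"
        using rR r0 by (intro nn_integral_powr_diff_le) (auto simp: less_imp_le)
      also have "\<dots> \<le> ennreal (2 powr R) * (1 + 1)"
        by (intro mult_left_mono add_mono w_r v_r) simp
      finally show ?thesis by (simp add: ennreal_mult)
    qed
    have "(\<lambda>n. \<integral>\<^sup>+x. ennreal (\<bar>w (k n) x - v x\<bar> powr q x) \<partial>?M) \<longlonglongrightarrow> 0"
    proof (rule nn_integral_powr_tendsto_zero[OF _ _ _ _ _ diff_r threshold])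
      show "AE x in ?M. (\<lambda>n. w (k n) x - v x) \<longlonglongrightarrow> 0"
        using lim by eventually_elim (simp add: LIM_zero)
      show "0 < q x \<and> q x \<le> ?r x" if "x \<in> space ?M" for x
        using qr[of x] that by simp
    qed auto
    then have "(\<lambda>n. luxemburg_norm \<Omega> q (\<lambda>x. L * (w (k n) x - v x))) \<longlonglongrightarrow> 0"
      using q0 qQ by (intro luxemburg_norm_tendsto_zero[where Q = Q]) (auto simp: less_imp_le)
    moreover have "L * (w n x - v x) = u n x - L * v x" for n x
      using L by (simp add: w_def right_diff_distrib)
    ultimately have "(\<lambda>n. luxemburg_norm \<Omega> q (\<lambda>x. u (k n) x - L * v x)) \<longlonglongrightarrow> 0"
      by simp
    moreover have "(\<lambda>x. L * v x) \<in> nakano_space \<Omega> q"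
    proof (rule subsetD[OF nakano_mono])
      have "(\<integral>\<^sup>+x. ennreal (\<bar>L * v x\<bar> powr ?r x) \<partial>?M)
          \<le> ennreal (max 1 \<bar>L\<bar> powr R) * (\<integral>\<^sup>+x. ennreal (\<bar>v x\<bar> powr ?r x) \<partial>?M)"
        using rR r0 by (intro nn_integral_powr_scale_le) (auto simp: less_imp_le)
      also have "\<dots> < \<infinity>"
        using v_r by (auto simp: ennreal_mult_less_top intro: le_less_trans)
      finally show "(\<lambda>x. L * v x) \<in> nakano_space \<Omega> ?r"
        by (simp add: nakano_space_def)
    qed
    ultimately show ?thesis
      using k by (intro bexI[of _ "\<lambda>x. L * v x"] exI[of _ k]) auto
  qed
  ultimately show ?thesis
    unfolding compact_embedding_def by blast
qed

end
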